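(* Suppose that $\mathcal A$ is surjective and that the KKT set $\Omega_\star$ is nonempty. Let $\tau,\sigma>0$ satisfy $\tau\sigma\|\mathcal A\|^2<1$, let $\{(X_k,y_k)\}$ be generated by the PDHG iteration from some initial point $(X_0,y_0)\in\mathbb S^n\times\mathbb R^m$, and set $S_k=C-\mathcal A^\ast y_k$. Suppose $(X_k,y_k,S_k)$ converges to a KKT point $(X_\star,y_\star,S_\star)\in\Omega_\star$ satisfying strict complementarity, $\operatorname{rank}X_\star+\operatorname{rank}S_\star=n$. Let $z_k=(X_k,y_k)$, $z_\star=(X_\star,y_\star)$, and let $\mathcal M$ be the local KKT manifold defined in the context. Then there exist $\rho_{\mathrm{SC}}\in(0,1)$ and $k_{\mathrm{SC}}\in\mathbb N$ such that for all $k\ge k_{\mathrm{SC}}$, $$\operatorname{dist}_P(z_{k+1},\mathcal M)\le\rho_{\mathrm{SC}}\operatorname{dist}_P(z_k,\mathcal M).$$ Moreover, there exists $\kappa_{\mathrm{SC}}>0$ such that for all $k\ge k_{\mathrm{SC}}$, $$\operatorname{dist}_P(z_k,\mathcal M)\le\kappa_{\mathrm{SC}}\,\rho_{\mathrm{SC}}^{\,k-k_{\mathrm{SC}}},\qquad \operatorname{dist}\big((X_k,y_k,S_k),\Omega_\star\big)\le\kappa_{\mathrm{SC}}\,\rho_{\mathrm{SC}}^{\,k-k_{\mathrm{SC}}},$$ and $$\|X_{k+1}-X_k\|_{\mathsf F}+\|y_{k+1}-y_k\|_2+\|S_{k+1}-S_k\|_{\mathsf F}\le\kappa_{\mathrm{SC}}\,\rho_{\mathrm{SC}}^{\,k-k_{\mathrm{SC}}},$$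 $$\|X_k-X_\star\|_{\mathsf F}+\|y_k-y_\star\|_2+\|S_k-S_\star\|_{\mathsf F}\le\kappa_{\mathrm{SC}}\,\rho_{\mathrm{SC}}^{\,k-k_{\mathrm{SC}}}.$$ If additionally $(X_\star,y_\star,S_\star)$ is locally isolated in $\Omega_\star$ (i.e., it is the only point of $\Omega_\star$ in some neighborhood of itself), then $z_k$ converges $Q$-linearly to $z_\star$ in the $P$-metric: there is $\rho\in(0,1)$ with $\|z_{k+1}-z_\star\|_P\le\rho\|z_k-z_\star\|_P$ for all sufficiently large $k$; equivalently, $(X_k,y_k,S_k)$ converges $Q$-linearly to $(X_\star,y_\star,S_\star)$, with the error of the triple $(X,y,C-\mathcal A^\ast y)$ measured by the $P$-norm of its $(X,y)$-component.
   Context: $\mathbb S^n$ is the space of real symmetric $n\times n$ matrices with inner product $\langle X,Y\rangle=\operatorname{tr}(XY)$ and Frobenius norm $\|\cdot\|_{\mathsf F}$; $\mathbb S^n_+$ is the cone of positive semidefinite matrices and $\Pi_{\mathbb S^n_+}$ the Euclidean projection onto it. Data: $C,A_1,\dots,A_m\in\mathbb S^n$, $b\in\mathbb R^m$; $\mathcal A:\mathbb S^n\to\mathbb R^m$, $\mathcal AX=(\langle A_1,X\rangle,\dots,\langle A_m,X\rangle)$, with adjoint $\mathcal A^\ast y=\sum_i y_iA_i$; $\|\mathcal A\|$ is the operator norm induced by the Frobenius and Euclidean norms. The SDP pair is: minimize $\langle C,X\rangle$ subject to $\mathcal AX=b$, $X\in\mathbb S^n_+$; and maximize $b^{\mathsf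 T}y$ subject to $\mathcal A^\ast y+S=C$, $S\in\mathbb S^n_+$. The KKT set is $$\Omega_\star=\{(X,y,S)\in\mathbb S^n\times\mathbb R^m\times\mathbb S^n\mid \mathcal AX=b,\ X\in\mathbb S^n_+,\ \mathcal A^\ast y+S=C,\ S\in\mathbb S^n_+,\ \langle X,S\rangle=0\};$$ its elements are called KKT points. PDHG iteration: $X_{k+1}=\Pi_{\mathbb S^n_+}\big(X_k-\tau(C-\mathcal A^\ast y_k)\big)$, $\ y_{k+1}=y_k+\sigma\big(b-\mathcal A(2X_{k+1}-X_k)\big)$. Metric: $P=\begin{bmatrix}\tau^{-1}\mathrm{Id}&\mathcal A^\ast\\ \mathcal A&\sigma^{-1}I_m\end{bmatrix}$ on $\mathbb S^n\times\mathbb R^m$, which is positive definite when $\tau\sigma\|\mathcal A\|^2<1$; $\langle u,v\rangle_P=\langle u,Pv\rangle$, so $\|(U,v)\|_P^2=\tau^{-1}\|U\|_{\mathsf F}^2+2v^{\mathsf T}\mathcal AU+\sigma^{-1}\|v\|_2^2$; $\operatorname{dist}_P(u,\mathcal C)=\inf_{v\in\mathcal C}\|u-v\|_P$. $\operatorname{dist}$ is the Euclidean distance in the product space. Local KKT manifold: let $r=\operatorname{rank}X_\star$. By complementarity and strict complementarity there is an orthogonal $Q_\star$ with $X_\star=Q_\star\begin{bmatrix}\Lambda_X&0\\0&0\end{bmatrix}Q_\star^{\mathsf T}$, $S_\star=Q_\star\begin{bmatrix}0&0\\0&\Lambda_S\end{bmatrix}Q_\star^{\mathsf T}$, where $\Lambda_X$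 ($r\times r$) and $\Lambda_S$ ($(n-r)\times(n-r)$) are diagonal with positive diagonal entries. Then $\mathcal M$ is the set of $(X,y)\in\mathbb S^n\times\mathbb R^m$ such that $\mathcal AX=b$, $X=Q_\star\begin{bmatrix}U_{11}&0\\0&0\end{bmatrix}Q_\star^{\mathsf T}$ for some $U_{11}\in\mathbb S^r$ with $U_{11}\succ0$, and $C-\mathcal A^\ast y=Q_\star\begin{bmatrix}0&0\\0&V_{22}\end{bmatrix}Q_\star^{\mathsf T}$ for some $V_{22}\in\mathbb S^{n-r}$ with $V_{22}\succ0$. *)

theory Defs
  imports "HOL-Analysis.Analysis"
begin

text \<open>On \<^typ>\<open>real^'n^'n\<close> the library inner product is the sum of entrywise products and the
  library norm is its Euclidean norm. For symmetric matrices these are the trace inner product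
  and the Frobenius norm, by the two lemmas below.\<close>

definition sym_mats :: "(real^'n^'n) set" where
  "sym_mats = {X. transpose X = X}"

lemma inner_sym_eq_trace:
  fixes X Y :: "real^'n^'n"
  assumes "X \<in> sym_mats"
  shows "X \<bullet> Y = trace (X ** Y)"
proof -
  have *: "X $ j $ i = X $ i $ j" for i j
    using assms by (metis (mono_tags) mem_Collect_eq sym_mats_def transpose_def vec_lambda_beta)
  have "trace (X ** Y) = (\<Sum>i\<in>UNIV. \<Sum>j\<in>UNIV. X $ i $ j * Y $ j $ i)"
    by (simp add: trace_def matrix_matrix_mult_def)
  also have "\<dots> = (\<Sum>j\<in>UNIV. \<Sum>i\<in>UNIV. X $ j $ i * Y $ j $ i)"
    by (subst sum.swap) (simp only: *)
  also have "\<dots> = X \<bullet> Y"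
    by (simp add: inner_vec_def)
  finally show ?thesis ..
qed

lemma norm_sym_eq_trace:
  fixes X :: "real^'n^'n"
  assumes "X \<in> sym_mats"
  shows "norm X = sqrt (trace (X ** X))"
  using inner_sym_eq_trace[OF assms, of X] by (simp add: norm_eq_sqrt_inner)

definition psd_cone :: "(real^'n^'n) set" where
  "psd_cone = {X \<in> sym_mats. \<forall>v. v \<bullet> (X *v v) \<ge> 0}"

definition opA :: "('m::finite \<Rightarrow> real^'n^'n) \<Rightarrow> real^'n^'n \<Rightarrow> real^'m" where
  "opA A X = (\<chi> i. A i \<bullet> X)"

definition adjA :: "('m::finite \<Rightarrow> real^'n^'n) \<Rightarrow> real^'m \<Rightarrow> real^'n^'n" where
  "adjA A y = (\<Sum>i\<in>UNIV. y $ i *\<^sub>R A i)"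

text \<open>As \<^const>\<open>onorm\<close>, but with the supremum over the domain of symmetric matrices.\<close>

definition opA_norm :: "('m::finite \<Rightarrow> real^'n^'n) \<Rightarrow> real" where
  "opA_norm A = (SUP X\<in>sym_mats. norm (opA A X) / norm X)"

definition KKT_set ::
  "('m::finite \<Rightarrow> real^'n^'n) \<Rightarrow> real^'m \<Rightarrow> real^'n^'n \<Rightarrow> ((real^'n^'n) \<times> (real^'m) \<times> (real^'n^'n)) set" where
  "KKT_set A b C = {(X, y, S). opA A X = b \<and> X \<in> psd_cone \<and>
     adjA A y + S = C \<and> S \<in> psd_cone \<and> X \<bullet> S = 0}"

definition pdhg_step ::
  "('m::finite \<Rightarrow> real^'n^'n) \<Rightarrow> real^'m \<Rightarrow> real^'n^'n \<Rightarrow> real \<Rightarrow> real \<Rightarrow>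
   (real^'n^'n) \<times> (real^'m) \<Rightarrow> (real^'n^'n) \<times> (real^'m)" where
  "pdhg_step A b C \<tau> \<sigma> = (\<lambda>(X, y).
     let X' = closest_point psd_cone (X - \<tau> *\<^sub>R (C - adjA A y))
     in (X', y + \<sigma> *\<^sub>R (b - opA A (2 *\<^sub>R X' - X))))"

definition P_op ::
  "('m::finite \<Rightarrow> real^'n^'n) \<Rightarrow> real \<Rightarrow> real \<Rightarrow>
   (real^'n^'n) \<times> (real^'m) \<Rightarrow> (real^'n^'n) \<times> (real^'m)" where
  "P_op A \<tau> \<sigma> = (\<lambda>(U, v). (inverse \<tau> *\<^sub>R U + adjA A v, opA A U + inverse \<sigma> *\<^sub>R v))"

definition P_norm ::
  "('m::finite \<Rightarrow> real^'n^'n) \<Rightarrow> real \<Rightarrow> real \<Rightarrow> (real^'n^'n) \<times> (real^'m) \<Rightarrow> real" where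
  "P_norm A \<tau> \<sigma> u = sqrt (u \<bullet> P_op A \<tau> \<sigma> u)"

definition P_triple_norm ::
  "('m::finite \<Rightarrow> real^'n^'n) \<Rightarrow> real \<Rightarrow> real \<Rightarrow>
   (real^'n^'n) \<times> (real^'m) \<times> (real^'n^'n) \<Rightarrow> real" where
  "P_triple_norm A \<tau> \<sigma> = (\<lambda>(U, v, W). P_norm A \<tau> \<sigma> (U, v))"

definition P_dist ::
  "('m::finite \<Rightarrow> real^'n^'n) \<Rightarrow> real \<Rightarrow> real \<Rightarrow>
   (real^'n^'n) \<times> (real^'m) \<Rightarrow> ((real^'n^'n) \<times> (real^'m)) set \<Rightarrow> real" where
  "P_dist A \<tau> \<sigma> u W = (INF w\<in>W. P_norm A \<tau> \<sigma> (u - w))"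

text \<open>Block matrices. An \<open>r \<times> r\<close> block is encoded by an index set \<open>I\<close> of cardinality \<open>r\<close>
  (playing the role of the first \<open>r\<close> indices) and the entries with both indices in \<open>I\<close> of an
  \<open>n \<times> n\<close> matrix \<open>U\<close>; \<open>corner I U\<close> is this block padded by zeros. The complementary block
  has index set \<open>- I\<close>.\<close>

definition corner :: "'n set \<Rightarrow> real^'n^'n \<Rightarrow> real^'n^'n" where
  "corner I U = (\<chi> i j. if i \<in> I \<and> j \<in> I then U $ i $ j else 0)"

definition pos_def_block :: "'n set \<Rightarrow> real^'n^'n \<Rightarrow> bool" where
  "pos_def_block I U \<longleftrightarrow> (\<forall>i\<in>I. \<forall>j\<in>I. U $ i $ j = U $ j $ i) \<and>
     (\<forall>v. (\<exists>i\<in>I. v i \<noteq> 0) \<longrightarrow> (\<Sum>i\<in>I. \<Sum>j\<in>I. v i * U $ i $ j * v j) > 0)"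

definition pos_diag_block :: "'n set \<Rightarrow> real^'n^'n \<Rightarrow> bool" where
  "pos_diag_block I D \<longleftrightarrow> (\<forall>i\<in>I. \<forall>j\<in>I. i \<noteq> j \<longrightarrow> D $ i $ j = 0) \<and> (\<forall>i\<in>I. D $ i $ i > 0)"

definition common_eigenframe ::
  "real^'n^'n \<Rightarrow> real^'n^'n \<Rightarrow> real^'n^'n \<Rightarrow> 'n set \<Rightarrow> bool" where
  "common_eigenframe X S Q I \<longleftrightarrow> orthogonal_matrix Q \<and> card I = rank X \<and>
     (\<exists>D. pos_diag_block I D \<and> X = Q ** corner I D ** transpose Q) \<and>
     (\<exists>D. pos_diag_block (- I) D \<and> S = Q ** corner (- I) D ** transpose Q)"

definition KKT_manifold ::
  "('m::finite \<Rightarrow> real^'n^'n) \<Rightarrow> real^'m \<Rightarrow> real^'n^'n \<Rightarrow>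
   real^'n^'n \<Rightarrow> 'n set \<Rightarrow> ((real^'n^'n) \<times> (real^'m)) set" where
  "KKT_manifold A b C Q I = {(X, y). opA A X = b \<and>
     (\<exists>U. pos_def_block I U \<and> X = Q ** corner I U ** transpose Q) \<and>
     (\<exists>V. pos_def_block (- I) V \<and> C - adjA A y = Q ** corner (- I) V ** transpose Q)}"

end

theory Submission
  imports Defs
begin

text \<open>One PDHG step solves \<open>0 \<in> T w + P (w - z)\<close> for the monotone KKT operator \<open>T\<close> of the SDP pair,
that is, it is a proximal-point step in the metric \<open>P\<close>. Hence, for every KKT point \<open>p\<close>,

  \<open>\<parallel>w - p\<parallel>\<^sup>2 + \<parallel>w - z\<parallel>\<^sup>2 \<le> \<parallel>z - p\<parallel>\<^sup>2\<close>  in the \<open>P\<close>-norm  (\<open>pdhg_fejer\<close>).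

A linear rate towards the manifold therefore only needs the local error bound
\<open>dist (w, M) \<le> K \<parallel>w - z\<parallel>\<close> (\<open>pdhg_error_bound\<close>): combining both and taking the infimum over \<open>p\<close> in the
manifold gives \<open>(1 + H\<^sup>2) dist (w, M)\<^sup>2 \<le> dist (z, M)\<^sup>2\<close> with some \<open>H > 0\<close> (\<open>dist_contraction\<close>).

The error bound rests on positive semidefiniteness and strict complementarity. Work in the
common eigenframe of \<open>Xs\<close> and \<open>Ss\<close>. The step produces the primal matrix \<open>X\<close> and a dual matrix \<open>Z\<close>,
both positive semidefinite with \<open>X \<bullet> Z = 0\<close>, and the residual \<open>R = P (w - z)\<close> measures by how much
\<open>(X, y, Z)\<close> violates the linear KKT equations; it is \<open>O (\<parallel>w - z\<parallel>)\<close>. Let \<open>p = (Xp, yp)\<close> be a nearby point of the manifold with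
slack \<open>Sp\<close>. Then \<open>X \<bullet> Sp + Xp \<bullet> Z = - (w - p) \<bullet> R\<close>. By strict complementarity the left-hand side
dominates the traces of the diagonal blocks of \<open>X\<close> and \<open>Z\<close> that vanish on the manifold, and for a
positive semidefinite matrix the square of an entry in a row or column of such a block is at most a
constant times this trace. So all blocks that vanish on the manifold are
\<open>O (sqrt (\<parallel>w - p\<parallel> \<parallel>R\<parallel>))\<close>. The manifold is an open piece of the affine space \<open>(Xs, ys) + ker G\<close>
(\<open>G\<close> is \<open>tangent_defect\<close>), hence, choosing \<open>p\<close> as the orthogonal projection of \<open>w\<close>,
\<open>\<parallel>w - p\<parallel> \<le> c \<parallel>G (w - (Xs, ys))\<parallel> = O (\<parallel>R\<parallel> + sqrt (\<parallel>w - p\<parallel> \<parallel>R\<parallel>))\<close>, which forces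
\<open>\<parallel>w - p\<parallel> = O (\<parallel>R\<parallel>)\<close>.

The remaining rates follow because the errors are controlled by the distance to the manifold: the
iterates do not move away from any of its points, so neither does their limit
(\<open>dist_to_limit_le\<close>). If the limit is isolated in the KKT set, the manifold is a single point
(\<open>isolated_manifold\<close>), and the contraction of the distance is the claimed Q-linear rate. A common
eigenframe of \<open>Xs\<close> and \<open>Ss\<close> is obtained by diagonalising \<open>Xs - Ss\<close> (\<open>common_eigenframe_exists\<close>).\<close>

section \<open>Symmetric and positive semidefinite matrices in an orthonormal frame\<close>

lemma sym_mats_subspace: "subspace sym_mats"
  unfolding sym_mats_def subspace_def
  by (auto simp: transpose_def vec_eq_iff)

lemma sym_mats_entry: "M \<in> sym_mats \<Longrightarrow> M $ j $ i = M $ i $ j"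
  by (metis (mono_tags) mem_Collect_eq sym_mats_def transpose_def vec_lambda_beta)

lemma sym_mats_dot: "M \<in> sym_mats \<Longrightarrow> u \<bullet> (M *v v) = v \<bullet> (M *v u)"
  by (metis (mono_tags) dot_lmul_matrix inner_commute mem_Collect_eq sym_mats_def
      transpose_matrix_vector)

lemma psd_coneD: "M \<in> psd_cone \<Longrightarrow> M \<in> sym_mats" "M \<in> psd_cone \<Longrightarrow> v \<bullet> (M *v v) \<ge> 0"
  by (auto simp: psd_cone_def)

lemma psd_cone_convex_cone: "convex_cone psd_cone"
  unfolding convex_cone_def
proof (intro conjI)
  show "convex psd_cone"
    unfolding convex_def
  proof (intro ballI allI impI)
    fix M N :: "real^'n^'n" and u v :: real
    assume *: "M \<in> psd_cone" "N \<in> psd_cone" "0 \<le> u" "0 \<le> v" "u + v = 1"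
    then have "u *\<^sub>R M + v *\<^sub>R N \<in> sym_mats"
      by (intro subspace_add subspace_scale sym_mats_subspace) (auto simp: psd_cone_def)
    moreover have "0 \<le> w \<bullet> ((u *\<^sub>R M + v *\<^sub>R N) *v w)" for w
      using * by (simp add: psd_cone_def matrix_vector_mult_add_rdistrib inner_right_distrib
          scaleR_matrix_vector_assoc[symmetric])
    ultimately show "u *\<^sub>R M + v *\<^sub>R N \<in> psd_cone" by (auto simp: psd_cone_def)
  qed
  show "conic psd_cone"
    unfolding conic_def
    by (auto simp: psd_cone_def subspace_scale[OF sym_mats_subspace] scaleR_matrix_vector_assoc[symmetric])
  show "psd_cone \<noteq> ({} :: (real^'n^'n) set)"
    by (auto simp: psd_cone_def subspace_0[OF sym_mats_subspace] intro!: exI[of _ 0])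
qed

lemma psd_cone_closed: "closed (psd_cone :: (real^'n^'n) set)"
proof -
  have "psd_cone = sym_mats \<inter> (\<Inter>v. {M :: real^'n^'n. 0 \<le> v \<bullet> (M *v v)})"
    by (auto simp: psd_cone_def)
  moreover have "closed (sym_mats :: (real^'n^'n) set)"
    by (intro closed_subspace sym_mats_subspace)
  moreover have "closed {M :: real^'n^'n. 0 \<le> v \<bullet> (M *v v)}" for v
    unfolding matrix_vector_mult_def inner_vec_def
    by (intro closed_Collect_le continuous_intros)
  ultimately show ?thesis by (metis (no_types, lifting) closed_INT closed_Int)
qed

lemma nonneg_quadratic_discriminant:
  fixes a b c :: real
  assumes "0 \<le> c" and nonneg: "\<And>t. 0 \<le> a + 2 * t * b + t\<^sup>2 * c"
  shows "b\<^sup>2 \<le> a * c"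
proof (cases "c = 0")
  case True
  have "b = 0"
  proof (rule ccontr)
    assume "b \<noteq> 0"
    then show False using nonneg[of "- (a + 1) / (2 * b)"] True by (simp add: field_simps)
  qed
  then show ?thesis using True by simp
next
  case False
  then have "c > 0" using \<open>0 \<le> c\<close> by simp
  then show ?thesis using nonneg[of "- b / c"]
    by (simp add: field_simps power2_eq_square)
qed

text \<open>A positive semidefinite matrix is a semi-inner product; the quadratic
  \<open>t \<mapsto> (u + t v) \<bullet> M (u + t v)\<close> is nonnegative, so its discriminant is not positive.\<close>

lemma psd_cone_Cauchy_Schwarz:
  assumes M: "M \<in> psd_cone"
  shows "(u \<bullet> (M *v v))\<^sup>2 \<le> (u \<bullet> (M *v u)) * (v \<bullet> (M *v v))"
proof (rule nonneg_quadratic_discriminant)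
  fix t :: real
  have "0 \<le> (u + t *\<^sub>R v) \<bullet> (M *v (u + t *\<^sub>R v))" using psd_coneD(2)[OF M] .
  also have "\<dots> = u \<bullet> (M *v u) + 2 * t * (u \<bullet> (M *v v)) + t\<^sup>2 * (v \<bullet> (M *v v))"
    using sym_mats_dot[OF psd_coneD(1)[OF M], of v u]
    by (simp add: algebra_simps matrix_vector_right_distrib matrix_vector_mult_scaleR power2_eq_square)
  finally show "0 \<le> u \<bullet> (M *v u) + 2 * t * (u \<bullet> (M *v v)) + t\<^sup>2 * (v \<bullet> (M *v v))" .
qed (rule psd_coneD(2)[OF M])

lemma psd_cone_null_vector:
  assumes M: "M \<in> psd_cone" and v: "v \<bullet> (M *v v) = 0"
  shows "M *v v = 0"
  using psd_cone_Cauchy_Schwarz[OF M, of "M *v v" v] v by simp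

text \<open>The matrix of the quadratic form \<open>M\<close> in the basis formed by the columns of \<open>Q\<close>.\<close>

definition frame_coords :: "real^'n^'n \<Rightarrow> real^'n^'n \<Rightarrow> real^'n^'n" where
  "frame_coords Q M = transpose Q ** M ** Q"

lemma frame_coords_entry: "frame_coords Q M $ i $ j = column i Q \<bullet> (M *v column j Q)"
proof -
  have "frame_coords Q M $ i $ j = (transpose Q ** (M ** Q)) $ i $ j"
    by (simp add: frame_coords_def matrix_mul_assoc)
  then show ?thesis
    by (simp add: transpose_def column_def matrix_vector_mult_def matrix_matrix_mult_def
        inner_vec_def)
qed

lemma linear_frame_coords: "linear (frame_coords Q)"
  by (rule linearI) (simp_all add: frame_coords_entry vec_eq_iff matrix_vector_mult_add_rdistrib
      inner_right_distrib scaleR_matrix_vector_assoc[symmetric])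

lemma frame_coords_inverse:
  assumes "orthogonal_matrix Q"
  shows "Q ** frame_coords Q M ** transpose Q = M" "frame_coords Q (Q ** M ** transpose Q) = M"
proof -
  have *: "Q ** transpose Q = mat 1" "transpose Q ** Q = mat 1"
    using assms by (auto simp: orthogonal_matrix_def)
  have "Q ** frame_coords Q M ** transpose Q = (Q ** transpose Q) ** M ** (Q ** transpose Q)"
    by (simp only: frame_coords_def matrix_mul_assoc)
  then show "Q ** frame_coords Q M ** transpose Q = M" by (simp add: *)
  have "frame_coords Q (Q ** M ** transpose Q) = (transpose Q ** Q) ** M ** (transpose Q ** Q)"
    by (simp only: frame_coords_def matrix_mul_assoc)
  then show "frame_coords Q (Q ** M ** transpose Q) = M" by (simp add: *)
qed

lemma inner_matrix_mult_left: "(L ** M) \<bullet> N = M \<bullet> (transpose L ** (N :: real^'n^'n))"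
proof -
  have "(L ** M) \<bullet> N = (\<Sum>i\<in>UNIV. \<Sum>j\<in>UNIV. \<Sum>k\<in>UNIV. L $ i $ k * M $ k $ j * N $ i $ j)"
    by (simp add: inner_vec_def matrix_matrix_mult_def sum_distrib_right)
  also have "\<dots> = (\<Sum>j\<in>UNIV. \<Sum>i\<in>UNIV. \<Sum>k\<in>UNIV. L $ i $ k * M $ k $ j * N $ i $ j)"
    by (rule sum.swap)
  also have "\<dots> = (\<Sum>j\<in>UNIV. \<Sum>k\<in>UNIV. \<Sum>i\<in>UNIV. L $ i $ k * M $ k $ j * N $ i $ j)"
    by (intro sum.cong refl sum.swap)
  also have "\<dots> = (\<Sum>k\<in>UNIV. \<Sum>j\<in>UNIV. \<Sum>i\<in>UNIV. L $ i $ k * M $ k $ j * N $ i $ j)"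
    by (rule sum.swap)
  also have "\<dots> = M \<bullet> (transpose L ** N)"
    by (simp add: inner_vec_def matrix_matrix_mult_def transpose_def sum_distrib_left ac_simps)
  finally show ?thesis .
qed

lemma inner_transpose: "transpose M \<bullet> transpose N = (M :: real^'n^'n) \<bullet> N"
  unfolding inner_vec_def transpose_def by simp (rule sum.swap)

lemma inner_matrix_mult_right:
  fixes M R N :: "real^'n^'n"
  shows "(M ** R) \<bullet> N = M \<bullet> (N ** transpose R)"
  using inner_matrix_mult_left[of "transpose R" "transpose M" "transpose N"]
    inner_transpose[of "M ** R" N] inner_transpose[of M "N ** transpose R"]
  by (simp add: matrix_transpose_mul)

lemma inner_frame_coords:
  assumes "orthogonal_matrix Q"
  shows "frame_coords Q M \<bullet> frame_coords Q N = M \<bullet> N"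
proof -
  have "frame_coords Q M \<bullet> frame_coords Q N = M \<bullet> (Q ** frame_coords Q N ** transpose Q)"
    using inner_matrix_mult_left[of "transpose Q" "M ** Q" "frame_coords Q N"]
      inner_matrix_mult_right[of M Q "Q ** frame_coords Q N"]
    by (simp add: frame_coords_def[of Q M] matrix_mul_assoc)
  then show ?thesis by (simp add: frame_coords_inverse assms)
qed

lemma norm_frame_coords:
  assumes "orthogonal_matrix Q"
  shows "norm (frame_coords Q M) = norm M"
  using inner_frame_coords[OF assms, of M M] by (simp add: norm_eq_sqrt_inner)

lemma frame_coords_sym: "M \<in> sym_mats \<Longrightarrow> frame_coords Q M \<in> sym_mats"
  using sym_mats_dot[of M] by (simp add: sym_mats_def transpose_def vec_eq_iff frame_coords_entry)

lemma frame_coords_psd: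
  assumes "M \<in> psd_cone"
  shows "frame_coords Q M \<in> psd_cone"
proof -
  have "v \<bullet> (frame_coords Q M *v v) = (Q *v v) \<bullet> (M *v (Q *v v))" for v
    unfolding frame_coords_def
    by (metis dot_lmul_matrix inner_commute matrix_vector_mul_assoc transpose_matrix_vector)
  then show ?thesis using assms frame_coords_sym[of M Q] by (auto simp: psd_cone_def)
qed

text \<open>The principal minors of order two and one. This is how a small diagonal entry forces its
  whole row and column to be small.\<close>

lemma psd_cone_entry:
  assumes M: "M \<in> psd_cone"
  shows "(M $ i $ j)\<^sup>2 \<le> M $ i $ i * M $ j $ j" "0 \<le> M $ i $ i"
proof -
  have e: "axis i 1 \<bullet> (M *v axis j 1) = M $ i $ j" for i j
    by (simp add: inner_axis' matrix_vector_mul_component inner_axis)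
  show "(M $ i $ j)\<^sup>2 \<le> M $ i $ i * M $ j $ j"
    using psd_cone_Cauchy_Schwarz[OF M, of "axis i 1" "axis j 1"] by (simp only: e)
  show "0 \<le> M $ i $ i" using psd_coneD(2)[OF M, of "axis i 1"] by (simp only: e)
qed

lemma norm_matrix_entry_le: "\<bar>M $ i $ j\<bar> \<le> norm (M :: real^'n^'m)"
  using Finite_Cartesian_Product.norm_nth_le[of M i] component_le_norm_cart[of "M $ i" j] by simp

section \<open>The spectral theorem\<close>

text \<open>A maximiser \<open>v\<close> of the Rayleigh quotient on the unit sphere of \<open>V\<close> is an eigenvector: with
  \<open>l\<close> the maximum, \<open>l (u \<bullet> u) - u \<bullet> f u\<close> is a nonnegative form that vanishes at \<open>v\<close>, so by the
  discriminant argument \<open>w \<bullet> f v = 0\<close> for every \<open>w\<close> in \<open>V\<close> orthogonal to \<open>v\<close>. The vector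
  \<open>w = f v - l v\<close> is orthogonal to \<open>v\<close>, hence to itself.\<close>

lemma selfadjoint_eigenvector:
  fixes f :: "'a::euclidean_space \<Rightarrow> 'a"
  assumes f: "linear f" "\<And>u v. u \<bullet> f v = v \<bullet> f u"
    and V: "subspace V" "f ` V \<subseteq> V" "V \<noteq> {0}"
  shows "\<exists>v\<in>V. norm v = 1 \<and> (\<exists>l. f v = l *\<^sub>R v)"
proof -
  have "compact (V \<inter> sphere 0 1)"
    using V(1) by (intro closed_Int_compact closed_subspace) auto
  moreover have "V \<inter> sphere 0 1 \<noteq> {}"
  proof -
    obtain u where "u \<in> V" "u \<noteq> 0" using V by (metis subspace_0 singletonI subsetI subset_antisym insert_subset singletonD)
    then have "(1 / norm u) *\<^sub>R u \<in> V \<inter> sphere 0 1" using V(1) by (simp add: subspace_scale)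
    then show ?thesis by blast
  qed
  moreover have "continuous_on (V \<inter> sphere 0 1) (\<lambda>v. v \<bullet> f v)"
    by (intro continuous_intros linear_continuous_on linear_conv_bounded_linear[THEN iffD1] f(1))
  ultimately have "\<exists>v\<in>V \<inter> sphere 0 1. \<forall>u\<in>V \<inter> sphere 0 1. u \<bullet> f u \<le> v \<bullet> f v"
    by (rule continuous_attains_sup)
  then obtain v where v: "v \<in> V" "norm v = 1"
    and vmax: "\<And>u. u \<in> V \<Longrightarrow> norm u = 1 \<Longrightarrow> u \<bullet> f u \<le> v \<bullet> f v"
    by auto
  define l where "l = v \<bullet> f v"
  have rayleigh: "u \<bullet> f u \<le> l * (u \<bullet> u)" if "u \<in> V" for u
  proof (cases "u = 0")
    case False
    have "((1 / norm u) *\<^sub>R u) \<bullet> f ((1 / norm u) *\<^sub>R u) \<le> l"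
      unfolding l_def using that False V(1) by (intro vmax) (simp_all add: subspace_scale)
    then have "(u \<bullet> f u) / (norm u)\<^sup>2 \<le> l"
      using f(1) by (simp add: linear_scale power2_eq_square)
    then show ?thesis using False by (simp add: dot_square_norm divide_le_eq)
  qed (simp add: linear_0[OF f(1)])
  define w where "w = f v - l *\<^sub>R v"
  have w: "w \<in> V" using V v(1) by (auto simp: w_def intro!: subspace_diff subspace_scale)
  have wv: "w \<bullet> v = 0" using v(2)
    by (simp add: w_def l_def inner_diff_left inner_commute[of "f v" v] dot_square_norm)
  have "(- (w \<bullet> f v))\<^sup>2 \<le> 0 * (l * (w \<bullet> w) - w \<bullet> f w)"
  proof (rule nonneg_quadratic_discriminant)
    show "0 \<le> l * (w \<bullet> w) - w \<bullet> f w" using rayleigh[OF w] by simp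
    fix t :: real
    have "v + t *\<^sub>R w \<in> V" using V(1) v(1) w by (simp add: subspace_add subspace_scale)
    from rayleigh[OF this] have "v \<bullet> f v + t * (v \<bullet> f w) + t * (w \<bullet> f v) + t\<^sup>2 * (w \<bullet> f w)
        \<le> l * (v \<bullet> v) + 2 * (l * (t * (w \<bullet> v))) + t\<^sup>2 * (l * (w \<bullet> w))"
      using f(1) by (simp add: linear_add linear_scale inner_add_left inner_add_right
          inner_commute[of v w] power2_eq_square algebra_simps)
    moreover have "v \<bullet> f w = w \<bullet> f v" by (rule f(2))
    moreover have "v \<bullet> v = 1" using v(2) by (simp add: dot_square_norm)
    ultimately show "0 \<le> 0 + 2 * t * (- (w \<bullet> f v)) + t\<^sup>2 * (l * (w \<bullet> w) - w \<bullet> f w)"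
      using wv by (simp add: l_def[symmetric] algebra_simps)
  qed
  then have "w \<bullet> f v = 0" by simp
  then have "w \<bullet> w = 0" using wv by (simp add: w_def[of ] inner_diff_right)
  then show ?thesis using v unfolding w_def by auto
qed

text \<open>Split off an eigenvector \<open>v\<close>; self-adjointness makes its orthogonal complement in \<open>V\<close>
  invariant again.\<close>

theorem selfadjoint_orthonormal_eigenbasis:
  fixes f :: "'a::euclidean_space \<Rightarrow> 'a"
  assumes f: "linear f" "\<And>u v. u \<bullet> f v = v \<bullet> f u"
    and V: "subspace V" "f ` V \<subseteq> V"
  shows "\<exists>B. pairwise orthogonal B \<and> (\<forall>b\<in>B. norm b = 1 \<and> (\<exists>l. f b = l *\<^sub>R b)) \<and> span B = V"
  using V
proof (induction "dim V" arbitrary: V rule: less_induct)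
  case less
  show ?case
  proof (cases "V = {0}")
    case True
    then show ?thesis by (intro exI[of _ "{}"]) auto
  next
    case False
    obtain v l where v: "v \<in> V" "norm v = 1" and l: "f v = l *\<^sub>R v"
      using selfadjoint_eigenvector[OF f less.prems False] by blast
    have vv: "v \<bullet> v = 1" using v(2) by (simp add: dot_square_norm)
    define W where "W = {x \<in> V. x \<bullet> v = 0}"
    have subW: "subspace W" using less.prems(1)
      by (auto simp: W_def subspace_def inner_add_left)
    have "f x \<in> W" if "x \<in> W" for x
      using that less.prems(2) l f(2)[of v x] by (auto simp: W_def inner_commute)
    then have "f ` W \<subseteq> W" by blast
    moreover have "dim W < dim V"
    proof -
      have "W \<subseteq> V" "v \<notin> W" using vv by (auto simp: W_def)
      then show ?thesis
        by (metis subW dim_subset le_neq_implies_less less.prems(1) order_refl subspace_dim_equal v(1))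
    qed
    ultimately obtain B where B: "pairwise orthogonal B" "span B = W"
      "\<forall>b\<in>B. norm b = 1 \<and> (\<exists>l. f b = l *\<^sub>R b)"
      using less.hyps[OF _ subW] by blast
    have orth: "b \<bullet> v = 0" if "b \<in> B" for b
      using that B(2) span_base[of b B] by (auto simp: W_def)
    have "span (insert v B) = V"
    proof
      have "B \<subseteq> V" using B(2) span_superset[of B] by (auto simp: W_def)
      then show "span (insert v B) \<subseteq> V" using v(1) less.prems(1) by (intro span_minimal) auto
      show "V \<subseteq> span (insert v B)"
      proof
        fix x assume x: "x \<in> V"
        have "x - (x \<bullet> v) *\<^sub>R v \<in> W"
          using x v(1) less.prems(1) vv
          by (auto simp: W_def inner_diff_left intro!: subspace_diff subspace_scale)
        then show "x \<in> span (insert v B)" unfolding span_breakdown_eq B(2)[symmetric] by blast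
      qed
    qed
    moreover have "pairwise orthogonal (insert v B)"
      using B(1) orth by (auto simp: pairwise_insert orthogonal_def inner_commute)
    ultimately show ?thesis using B(3) v(2) l by (intro exI[of _ "insert v B"]) auto
  qed
qed

lemma sym_mats_orthogonal_eigenvectors:
  fixes M :: "real^'n^'n"
  assumes M: "M \<in> sym_mats"
  obtains Q and l :: "'n \<Rightarrow> real"
  where "orthogonal_matrix Q" "\<And>i. M *v column i Q = l i *\<^sub>R column i Q"
proof -
  have "linear ((*v) M)" by (rule matrix_vector_mul_linear)
  then obtain B where B: "pairwise orthogonal B" "span B = (UNIV :: (real^'n) set)"
    "\<forall>b\<in>B. norm b = 1 \<and> (\<exists>l. M *v b = l *\<^sub>R b)"
    using selfadjoint_orthonormal_eigenbasis[of "(*v) M" UNIV] sym_mats_dot[OF M] by auto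
  have "0 \<notin> B" using B(3) by auto
  then have "independent B" using B(1) pairwise_orthogonal_independent by blast
  then have "card B = CARD('n)" "finite B"
    using B(2) dim_eq_card[of B UNIV] independent_bound[of B] by (auto simp: dim_UNIV)
  then obtain q where q: "bij_betw q (UNIV :: 'n set) B"
    by (metis finite_same_card_bij finite)
  define Q :: "real^'n^'n" where "Q = (\<chi> i j. q j $ i)"
  have col: "column j Q = q j" for j by (simp add: Q_def column_def vec_eq_iff)
  have "orthogonal_matrix Q"
    unfolding orthogonal_matrix_orthonormal_columns col
    using q B(1,3) by (metis bij_betw_def inj_eq pairwiseD rangeI)
  moreover have "\<forall>i. \<exists>l. M *v column i Q = l *\<^sub>R column i Q"
    using q B(3) by (auto simp: col bij_betw_def)
  then obtain l where "\<And>i. M *v column i Q = l i *\<^sub>R column i Q" by metis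
  ultimately show ?thesis using that by blast
qed

section \<open>Complementary positive semidefinite matrices\<close>

lemma matrix_zero_on_orthonormal_columns:
  assumes Q: "orthogonal_matrix Q" and "\<And>j. (M :: real^'n^'n) *v column j Q = 0"
  shows "M = 0"
proof -
  have "frame_coords Q M = 0" by (simp add: vec_eq_iff[of "frame_coords Q M"]
      vec_eq_iff[of "frame_coords Q M $ _"] frame_coords_entry assms(2))
  then show ?thesis using norm_frame_coords[OF Q, of M] by simp
qed

lemma orthogonal_matrix_columns_dot:
  assumes "orthogonal_matrix (Q :: real^'n^'n)"
  shows "column i Q \<bullet> column j Q = (if i = j then 1 else 0)"
  using assms by (auto simp: orthogonal_matrix_orthonormal_columns orthogonal_def dot_square_norm)

lemma frame_coords_eigenvectors:
  assumes "orthogonal_matrix Q" "\<And>i. M *v column i Q = l i *\<^sub>R column i Q"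
  shows "frame_coords Q M = (\<chi> i j. if i = j then l i else 0)"
  by (simp add: vec_eq_iff frame_coords_entry assms orthogonal_matrix_columns_dot)

lemma rank_eq_card_nonzero_eigenvalues:
  assumes Q: "orthogonal_matrix (Q :: real^'n^'n)" and l: "\<And>i. M *v column i Q = l i *\<^sub>R column i Q"
  shows "rank M = card {i. l i \<noteq> 0}"
proof -
  let ?q = "\<lambda>i. column i Q" and ?I = "{i. l i \<noteq> 0}"
  have inj: "inj ?q"
    using orthogonal_matrix_columns_dot[OF Q] by (metis (mono_tags) injI zero_neq_one)
  have nz: "?q i \<noteq> 0" for i using orthogonal_matrix_columns_dot[OF Q, of i i] by auto
  have "pairwise orthogonal (?q ` ?I)"
    using orthogonal_matrix_columns_dot[OF Q] by (auto simp: pairwise_def orthogonal_def)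
  then have "independent (?q ` ?I)" using nz by (intro pairwise_orthogonal_independent) auto
  moreover have "range ((*v) M) = span (?q ` ?I)"
  proof
    have "M *v v \<in> span (?q ` ?I)" for v
    proof -
      have "v = Q *v (transpose Q *v v)"
        using Q by (simp add: matrix_vector_mul_assoc orthogonal_matrix_def del: transpose_matrix_vector)
      then have v: "v = (\<Sum>i\<in>UNIV. (transpose Q *v v) $ i *\<^sub>R ?q i)"
        by (metis (no_types, lifting) matrix_mult_sum scalar_mult_eq_scaleR sum.cong)
      have "M *v v = (\<Sum>i\<in>UNIV. (transpose Q *v v) $ i *\<^sub>R (l i *\<^sub>R ?q i))"
        by (subst v, simp only: linear_sum[OF matrix_vector_mul_linear] o_def
            linear_scale[OF matrix_vector_mul_linear] l)
      also have "\<dots> \<in> span (?q ` ?I)"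
      proof (rule span_sum, rule span_scale)
        fix i show "l i *\<^sub>R ?q i \<in> span (?q ` ?I)"
          by (cases "l i = 0") (simp_all add: span_zero span_scale span_base)
      qed
      finally show ?thesis .
    qed
    then show "range ((*v) M) \<subseteq> span (?q ` ?I)" by blast
    have "?q i \<in> range ((*v) M)" if "l i \<noteq> 0" for i
      using that by (intro image_eqI[of _ _ "(1 / l i) *\<^sub>R ?q i"])
        (simp_all add: matrix_vector_mult_scaleR l)
    then show "span (?q ` ?I) \<subseteq> range ((*v) M)"
      by (intro span_minimal linear_subspace_image[OF matrix_vector_mul_linear]) auto
  qed
  ultimately have "rank M = card (?q ` ?I)"
    by (simp add: rank_dim_range dim_eq_card_independent)
  then show ?thesis using inj by (simp add: card_image inj_on_subset)
qed

lemma inner_eq_sum_eigenvalues: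
  fixes X S Q :: "real^'n^'n"
  assumes Q: "orthogonal_matrix Q" and l: "\<And>i. X *v column i Q = l i *\<^sub>R column i Q"
  shows "X \<bullet> S = (\<Sum>i\<in>UNIV. l i * (column i Q \<bullet> (S *v column i Q)))"
proof -
  have "X \<bullet> S = frame_coords Q X \<bullet> frame_coords Q S" using inner_frame_coords[OF Q] by simp
  also have "\<dots> = (\<Sum>i\<in>UNIV. l i * (column i Q \<bullet> (S *v column i Q)))"
    by (simp add: frame_coords_eigenvectors[OF Q l] inner_vec_def[of "vec_lambda _"]
        inner_vec_def[of "vec_lambda _" "frame_coords Q S $ _"] frame_coords_entry
        if_distrib[of "\<lambda>x. x * _"] cong: if_cong)
  finally show ?thesis .
qed

text \<open>The easy half of the self-duality of the cone, read off in an eigenframe of one factor.\<close>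

lemma psd_cone_inner_nonneg:
  assumes X: "X \<in> psd_cone" and S: "S \<in> psd_cone"
  shows "0 \<le> X \<bullet> S"
proof -
  obtain Q l where Q: "orthogonal_matrix Q" and l: "\<And>i. X *v column i Q = l i *\<^sub>R column i Q"
    using sym_mats_orthogonal_eigenvectors[OF psd_coneD(1)[OF X]] by blast
  have "l i \<ge> 0" for i
    using psd_coneD(2)[OF X, of "column i Q"] by (simp add: l orthogonal_matrix_columns_dot[OF Q])
  then show ?thesis unfolding inner_eq_sum_eigenvalues[OF Q l]
    by (intro sum_nonneg mult_nonneg_nonneg psd_coneD(2)[OF S])
qed

text \<open>In an eigenframe of \<open>X\<close>, the vanishing of the nonnegative sum \<open>X \<bullet> S\<close> means that \<open>S\<close> kills
  every eigenvector of \<open>X\<close> with nonzero eigenvalue, hence the range of \<open>X\<close>.\<close>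

lemma psd_cone_complementary_product:
  assumes X: "X \<in> psd_cone" and S: "S \<in> psd_cone" and XS: "X \<bullet> S = 0"
  shows "S ** X = 0" "X ** S = 0"
proof -
  obtain Q l where Q: "orthogonal_matrix Q" and l: "\<And>i. X *v column i Q = l i *\<^sub>R column i Q"
    using sym_mats_orthogonal_eigenvectors[OF psd_coneD(1)[OF X]] by blast
  have l_nonneg: "l i \<ge> 0" for i
    using psd_coneD(2)[OF X, of "column i Q"] by (simp add: l orthogonal_matrix_columns_dot[OF Q])
  have sum0: "(\<Sum>i\<in>UNIV. l i * (column i Q \<bullet> (S *v column i Q))) = 0"
    using inner_eq_sum_eigenvalues[OF Q l, of S] XS by simp
  have "l i * (column i Q \<bullet> (S *v column i Q)) = 0" for i
    by (rule sum_nonneg_0[OF finite_class.finite_UNIV _ sum0])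
      (simp_all add: l_nonneg psd_coneD(2)[OF S])
  then have "l i = 0 \<or> S *v column i Q = 0" for i
    using psd_cone_null_vector[OF S] by (metis mult_eq_0_iff)
  then have "(S ** X) *v column i Q = 0" for i
    by (auto simp: l matrix_vector_mul_assoc[symmetric] matrix_vector_mult_scaleR)
  then show SX: "S ** X = 0" by (rule matrix_zero_on_orthonormal_columns[OF Q])
  have "X ** S = transpose (S ** X)"
    using psd_coneD(1)[OF X] psd_coneD(1)[OF S] by (simp add: matrix_transpose_mul sym_mats_def)
  then show "X ** S = 0" by (simp add: SX transpose_def vec_eq_iff)
qed

text \<open>If \<open>M\<close> and \<open>N\<close> annihilate each other, they are the positive and the negative part of
  \<open>M - N\<close>, so an eigenvector of the difference is an eigenvector of both.\<close>

lemma complementary_psd_eigenvector: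
  fixes M N :: "real^'n^'n"
  assumes M: "M \<in> psd_cone" and N: "N \<in> psd_cone" and MN: "M ** N = 0" and NM: "N ** M = 0"
    and q: "(M - N) *v q = w *\<^sub>R q"
  shows "M *v q = max 0 w *\<^sub>R q"
proof (cases "w > 0")
  case True
  have "w *\<^sub>R (N *v q) = N *v ((M - N) *v q)" by (simp add: q matrix_vector_mult_scaleR)
  also have "\<dots> = - (N *v (N *v q))"
    using NM by (simp add: matrix_vector_mult_diff_rdistrib matrix_vector_mult_diff_distrib
        matrix_vector_mul_assoc)
  finally have "w * ((N *v q) \<bullet> (N *v q)) = - ((N *v q) \<bullet> (N *v (N *v q)))"
    by (metis inner_minus_right inner_scaleR_right)
  also have "\<dots> \<le> 0" using psd_coneD(2)[OF N] by simp
  finally have "(N *v q) \<bullet> (N *v q) \<le> 0" using True by (simp add: mult_le_0_iff)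
  then have "(N *v q) \<bullet> (N *v q) = 0" using inner_ge_zero by (rule order_antisym)
  then have "N *v q = 0" by simp
  then show ?thesis using q True by (simp add: matrix_vector_mult_diff_rdistrib)
next
  case False
  have "M *v ((M - N) *v q) = M *v (M *v q)"
    using MN by (simp add: matrix_vector_mult_diff_rdistrib matrix_vector_mult_diff_distrib
        matrix_vector_mul_assoc)
  then have MM: "M *v (M *v q) = w *\<^sub>R (M *v q)" by (simp add: q matrix_vector_mult_scaleR)
  have "(M *v q) \<bullet> (M *v q) = q \<bullet> (M *v (M *v q))"
    using sym_mats_dot[OF psd_coneD(1)[OF M]] by simp
  also have "\<dots> \<le> 0" using False psd_coneD(2)[OF M, of q] by (simp add: MM mult_nonpos_nonneg)
  finally have "(M *v q) \<bullet> (M *v q) \<le> 0" .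
  then have "(M *v q) \<bullet> (M *v q) = 0" using inner_ge_zero by (rule order_antisym)
  then have "M *v q = 0" by simp
  then show ?thesis using False by simp
qed

text \<open>The rank condition excludes the eigenvalue 0 of \<open>X - S\<close>, so the complement of the set \<open>I\<close>
  of its positive eigenvalues consists of the negative ones.\<close>

lemma common_eigenframe_exists:
  fixes X S :: "real^'n^'n"
  assumes X: "X \<in> psd_cone" and S: "S \<in> psd_cone" and XS: "X \<bullet> S = 0"
    and rank: "rank X + rank S = CARD('n)"
  shows "\<exists>Q I. common_eigenframe X S Q I"
proof -
  note prod = psd_cone_complementary_product[OF X S XS]
  have "X - S \<in> sym_mats" using X S by (intro subspace_diff sym_mats_subspace) (auto dest: psd_coneD)
  then obtain Q w where Q: "orthogonal_matrix Q"
    and w: "\<And>i. (X - S) *v column i Q = w i *\<^sub>R column i Q"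
    using sym_mats_orthogonal_eigenvectors by blast
  have Xq: "X *v column i Q = max 0 (w i) *\<^sub>R column i Q" for i
    by (rule complementary_psd_eigenvector[OF X S prod(2,1) w])
  have "(S - X) *v column i Q = (- w i) *\<^sub>R column i Q" for i
    using w[of i] by (simp add: matrix_vector_mult_diff_rdistrib algebra_simps)
  then have Sq: "S *v column i Q = max 0 (- w i) *\<^sub>R column i Q" for i
    by (rule complementary_psd_eigenvector[OF S X prod])
  define I where "I = {i. w i > 0}"
  have rX: "rank X = card I"
    unfolding rank_eq_card_nonzero_eigenvalues[OF Q Xq] I_def by (rule arg_cong[of _ _ card]) auto
  have rS: "rank S = card {i. w i < 0}"
    unfolding rank_eq_card_nonzero_eigenvalues[OF Q Sq] by (rule arg_cong[of _ _ card]) auto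
  have "card (- I) = CARD('n) - card I" by (simp add: Compl_eq_Diff_UNIV card_Diff_subset)
  then have "{i. w i < 0} = - I"
    using rank rX rS by (intro card_subset_eq) (auto simp: I_def)
  then have negI: "w i < 0" if "i \<notin> I" for i using that by blast
  have "pos_diag_block I (frame_coords Q X)"
    "corner I (frame_coords Q X) = frame_coords Q X"
    unfolding frame_coords_eigenvectors[OF Q Xq]
    by (auto simp: pos_diag_block_def I_def corner_def vec_eq_iff)
  moreover have "pos_diag_block (- I) (frame_coords Q S)"
    "corner (- I) (frame_coords Q S) = frame_coords Q S"
    unfolding frame_coords_eigenvectors[OF Q Sq] using negI
    by (auto simp: pos_diag_block_def corner_def vec_eq_iff) (auto simp: I_def)
  ultimately have "common_eigenframe X S Q I"
    unfolding common_eigenframe_def using Q rX frame_coords_inverse(1)[OF Q] by metis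
  then show ?thesis by blast
qed

section \<open>The preconditioned proximal-point form of PDHG\<close>

lemma linear_opA: "linear (opA A)"
  by (rule linearI) (simp_all add: opA_def vec_eq_iff inner_add_right)

lemma linear_adjA: "linear (adjA A)"
  by (rule linearI)
    (simp_all add: adjA_def scaleR_add_left sum.distrib scaleR_sum_right)

lemma opA_adjA: "opA A X \<bullet> v = X \<bullet> adjA A v"
  by (simp add: opA_def adjA_def inner_vec_def[of "vec_lambda _"] inner_sum_right
      inner_commute[of X] mult.commute)

lemma linear_P_op: "linear (P_op A \<tau> \<sigma>)"
  by (rule linearI) (auto simp: P_op_def split_beta linear_add[OF linear_opA] linear_add[OF linear_adjA]
      linear_scale[OF linear_opA] linear_scale[OF linear_adjA] algebra_simps)

lemma P_op_selfadjoint: "u \<bullet> P_op A \<tau> \<sigma> w = w \<bullet> P_op A \<tau> \<sigma> u"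
proof -
  have "u \<bullet> P_op A \<tau> \<sigma> w = inverse \<tau> * (fst u \<bullet> fst w) + opA A (fst u) \<bullet> snd w
      + opA A (fst w) \<bullet> snd u + inverse \<sigma> * (snd u \<bullet> snd w)" for u w
    by (simp add: P_op_def split_beta inner_prod_def inner_add_right opA_adjA[symmetric]
        inner_commute[of "snd u" "opA A (fst w)"])
  from this[of u w] this[of w u] show ?thesis
    by (simp add: inner_commute[of "fst w" "fst u"] inner_commute[of "snd w" "snd u"])
qed

text \<open>The quotients whose supremum is the operator norm are bounded, so the supremum bounds each
  of them.\<close>

lemma opA_norm_bound:
  assumes X: "X \<in> sym_mats"
  shows "norm (opA A X) \<le> opA_norm A * norm X"
proof (cases "X = 0")
  case False
  obtain K where K: "norm (opA A Y) \<le> K * norm Y" "K \<ge> 0" for Y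
    using linear_bounded_pos[OF linear_opA[of A]] by (metis less_imp_le)
  have "bdd_above ((\<lambda>Y. norm (opA A Y) / norm Y) ` sym_mats)"
  proof (rule bdd_aboveI2)
    fix Y show "norm (opA A Y) / norm Y \<le> K"
      using K(1)[of Y] K(2) by (cases "Y = 0") (simp_all add: divide_le_eq)
  qed
  then have "norm (opA A X) / norm X \<le> opA_norm A"
    unfolding opA_norm_def using X by (intro cSUP_upper)
  then show ?thesis using False by (simp add: divide_le_eq)
qed (simp add: linear_0[OF linear_opA])

locale sdp_pdhg =
  fixes A :: "'m::finite \<Rightarrow> real^'n^'n" and b :: "real^'m" and C :: "real^'n^'n"
    and \<tau> \<sigma> :: real
  assumes C_sym: "C \<in> sym_mats" and A_sym: "\<And>i. A i \<in> sym_mats"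
    and \<tau>: "\<tau> > 0" and \<sigma>: "\<sigma> > 0" and step_product: "\<tau> * \<sigma> * (opA_norm A)\<^sup>2 < 1"
begin

abbreviation "P \<equiv> P_op A \<tau> \<sigma>"

lemma adjA_sym: "adjA A v \<in> sym_mats"
  unfolding adjA_def by (intro subspace_sum subspace_scale sym_mats_subspace A_sym)

text \<open>Young's inequality bounds the cross term by the fraction \<open>\<theta> = sqrt (\<tau> \<sigma>) \<parallel>A\<parallel> < 1\<close> of the
  diagonal terms. The operator norm only sees symmetric matrices, whence the condition on the
  matrix component.\<close>

lemma P_coercive:
  obtains c where "c > 0" "\<And>u. fst u \<in> sym_mats \<Longrightarrow> c * (norm u)\<^sup>2 \<le> u \<bullet> P u"
proof -
  define \<theta> where "\<theta> = sqrt (\<tau> * \<sigma>) * \<bar>opA_norm A\<bar>"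
  have "\<theta>\<^sup>2 < 1" using step_product \<tau> \<sigma> by (simp add: \<theta>_def power_mult_distrib)
  then have \<theta>: "\<theta> < 1" "0 \<le> \<theta>"
    using \<tau> \<sigma> by (auto simp: \<theta>_def abs_square_less_1)
  define c where "c = (1 - \<theta>) * min (1 / \<tau>) (1 / \<sigma>)"
  have "c > 0" using \<theta> \<tau> \<sigma> by (simp add: c_def)
  moreover have "c * (norm u)\<^sup>2 \<le> u \<bullet> P u" if u: "fst u \<in> sym_mats" for u
  proof -
    obtain U v where uv: "u = (U, v)" by (cases u)
    define p where "p = norm U / sqrt \<tau>"
    define q where "q = norm v / sqrt \<sigma>"
    have p2: "p\<^sup>2 = (norm U)\<^sup>2 / \<tau>" "q\<^sup>2 = (norm v)\<^sup>2 / \<sigma>"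
      using \<tau> \<sigma> by (simp_all add: p_def q_def power_divide)
    have "\<bar>opA A U \<bullet> v\<bar> \<le> norm (opA A U) * norm v" by (rule Cauchy_Schwarz_ineq2)
    also have "\<dots> \<le> (\<bar>opA_norm A\<bar> * norm U) * norm v"
      using opA_norm_bound[of U A] u uv
      by (intro mult_right_mono order_trans[OF opA_norm_bound] mult_right_mono) auto
    also have "\<dots> = \<theta> * (p * q)"
      using \<tau> \<sigma> by (simp add: \<theta>_def p_def q_def real_sqrt_mult)
    also have "\<dots> \<le> \<theta> * ((p\<^sup>2 + q\<^sup>2) / 2)"
      using \<theta>(2) sum_squares_bound[of p q] by (intro mult_left_mono) auto
    finally have "- (2 * (opA A U \<bullet> v)) \<le> \<theta> * (p\<^sup>2 + q\<^sup>2)" by linarith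
    then have "(1 - \<theta>) * (p\<^sup>2 + q\<^sup>2) \<le> p\<^sup>2 + 2 * (opA A U \<bullet> v) + q\<^sup>2"
      by (simp add: algebra_simps)
    also have "\<dots> = u \<bullet> P u"
      by (simp add: uv p2 P_op_def inner_add_right opA_adjA[symmetric] inner_commute dot_square_norm
          divide_inverse)
    finally have *: "(1 - \<theta>) * (p\<^sup>2 + q\<^sup>2) \<le> u \<bullet> P u" .
    have "min (1 / \<tau>) (1 / \<sigma>) * (norm u)\<^sup>2 = min (1 / \<tau>) (1 / \<sigma>) * (norm U)\<^sup>2 + min (1 / \<tau>) (1 / \<sigma>) * (norm v)\<^sup>2"
      by (simp add: uv norm_Pair algebra_simps)
    also have "\<dots> \<le> (1 / \<tau>) * (norm U)\<^sup>2 + (1 / \<sigma>) * (norm v)\<^sup>2"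
      by (intro add_mono mult_right_mono) auto
    finally have "min (1 / \<tau>) (1 / \<sigma>) * (norm u)\<^sup>2 \<le> p\<^sup>2 + q\<^sup>2" by (simp add: p2)
    then have "c * (norm u)\<^sup>2 \<le> (1 - \<theta>) * (p\<^sup>2 + q\<^sup>2)"
      unfolding c_def mult.assoc using \<theta>(1) by (intro mult_left_mono) auto
    then show ?thesis using * by linarith
  qed
  ultimately show ?thesis using that by blast
qed

lemma P_norm_nonneg: "0 \<le> u \<bullet> P u" if "fst u \<in> sym_mats"
proof (rule P_coercive)
  fix c :: real assume "c > 0" and c: "\<And>u. fst u \<in> sym_mats \<Longrightarrow> c * (norm u)\<^sup>2 \<le> u \<bullet> P u"
  have "0 \<le> c * (norm u)\<^sup>2" using \<open>c > 0\<close> by simp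
  also have "\<dots> \<le> u \<bullet> P u" using that by (rule c)
  finally show ?thesis .
qed

lemma P_norm_sq: "(P_norm A \<tau> \<sigma> u)\<^sup>2 = u \<bullet> P u" "0 \<le> P_norm A \<tau> \<sigma> u" if "fst u \<in> sym_mats"
  using P_norm_nonneg[OF that] by (simp_all add: P_norm_def)

lemma P_norm_equiv:
  obtains c K where "c > 0" "K > 0"
    "\<And>u. fst u \<in> sym_mats \<Longrightarrow> c * norm u \<le> P_norm A \<tau> \<sigma> u"
    "\<And>u. fst u \<in> sym_mats \<Longrightarrow> P_norm A \<tau> \<sigma> u \<le> K * norm u"
    "\<And>u. norm (P u) \<le> K * norm u"
proof -
  obtain c where c: "c > 0" "\<And>u. fst u \<in> sym_mats \<Longrightarrow> c * (norm u)\<^sup>2 \<le> u \<bullet> P u"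
    using P_coercive by blast
  obtain L where L: "L > 0" "\<And>u. norm (P u) \<le> L * norm u"
    using linear_bounded_pos[OF linear_P_op[of A \<tau> \<sigma>]] by blast
  define K where "K = max L (sqrt L)"
  have "sqrt c * norm u \<le> P_norm A \<tau> \<sigma> u" if "fst u \<in> sym_mats" for u
    unfolding P_norm_def using real_sqrt_le_mono[OF c(2)[OF that]] by (simp add: real_sqrt_mult)
  moreover have "P_norm A \<tau> \<sigma> u \<le> K * norm u" for u
  proof -
    have "u \<bullet> P u \<le> norm u * (L * norm u)"
      using norm_cauchy_schwarz[of u "P u"] L(2)[of u] by (meson mult_left_mono norm_ge_zero order_trans)
    also have "\<dots> = L * (norm u)\<^sup>2" by (simp add: power2_eq_square)
    finally have "P_norm A \<tau> \<sigma> u \<le> sqrt L * norm u"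
      unfolding P_norm_def using real_sqrt_le_mono by (fastforce simp: real_sqrt_mult)
    also have "\<dots> \<le> K * norm u" by (intro mult_right_mono) (auto simp: K_def)
    finally show ?thesis .
  qed
  moreover have "norm (P u) \<le> K * norm u" for u
    using L(2)[of u] by (rule order_trans) (auto simp: K_def intro!: mult_right_mono)
  ultimately show ?thesis using that[of "sqrt c" K] c(1) L(1) by (auto simp: K_def)
qed

text \<open>By the Moreau decomposition, the part \<open>\<tau>\<^sup>-\<^sup>1 (\<Pi> Y - Y)\<close> that the projection of
  \<open>Y = X - \<tau> (C - A\<^sup>* y)\<close> adds is positive semidefinite and complementary to \<open>\<Pi> Y\<close>. It serves as
  dual variable: unlike the slack \<open>C - A\<^sup>* y\<close> of the iterates, it lies in the cone after every
  step.\<close>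

definition dual_iterate :: "(real^'n^'n) \<times> (real^'m) \<Rightarrow> (real^'n^'n) \<times> (real^'m) \<Rightarrow> real^'n^'n" where
  "dual_iterate z w = inverse \<tau> *\<^sub>R (fst w - fst z) + (C - adjA A (snd z))"

lemma pdhg_step_complementary:
  assumes z: "fst z \<in> sym_mats" and w: "w = pdhg_step A b C \<tau> \<sigma> z"
  shows "fst w \<in> psd_cone" "dual_iterate z w \<in> psd_cone" "fst w \<bullet> dual_iterate z w = 0"
proof -
  define Y where "Y = fst z - \<tau> *\<^sub>R (C - adjA A (snd z))"
  have fw: "fst w = closest_point psd_cone Y"
    by (simp add: w pdhg_step_def split_beta Y_def Let_def)
  have cone: "convex (psd_cone :: (real^'n^'n) set)" "closed (psd_cone :: (real^'n^'n) set)"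
    "conic (psd_cone :: (real^'n^'n) set)" "(psd_cone :: (real^'n^'n) set) \<noteq> {}"
    using psd_cone_convex_cone psd_cone_closed by (auto simp: convex_cone_def)
  show X: "fst w \<in> psd_cone" unfolding fw by (rule closest_point_in_set[OF cone(2,4)])
  have "dual_iterate z w = inverse \<tau> *\<^sub>R (fst w - Y)"
    using \<tau> by (simp add: dual_iterate_def Y_def algebra_simps)
  then have Z: "dual_iterate z w \<bullet> (K - fst w) \<ge> 0" if "K \<in> psd_cone" for K
    using closest_point_dot[OF cone(1,2) that, of Y] \<tau> unfolding fw[symmetric]
    by (simp add: inner_diff_left zero_le_mult_iff)
  \<comment> \<open>Testing the variational inequality with both multiples of the projection gives
    orthogonality.\<close>
  have "2 *\<^sub>R fst w \<in> psd_cone" "0 *\<^sub>R fst w \<in> psd_cone"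
    using cone(3) X by (auto simp: conic_def simp del: scale_zero_left scaleR_zero_left)
  from this[THEN Z] have Zw: "dual_iterate z w \<bullet> fst w = 0"
    by (simp add: inner_diff_right scaleR_2 inner_add_right)
  then show "fst w \<bullet> dual_iterate z w = 0" by (simp add: inner_commute)
  have "0 \<le> v \<bullet> (dual_iterate z w *v v)" for v
  proof -
    \<comment> \<open>The rank-one matrices \<open>v v\<^sup>T\<close> suffice to test semidefiniteness.\<close>
    define K :: "real^'n^'n" where "K = (\<chi> i j. v $ i * v $ j)"
    have "u \<bullet> (K *v u) = (u \<bullet> v)\<^sup>2" for u
      by (simp add: K_def matrix_vector_mult_def inner_vec_def power2_eq_square sum_product
          sum_distrib_left ac_simps)
    then have "K \<in> psd_cone"
      by (auto simp: psd_cone_def sym_mats_def K_def transpose_def vec_eq_iff)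
    from Z[OF this] have "0 \<le> dual_iterate z w \<bullet> K" using Zw by (simp add: inner_diff_right)
    also have "\<dots> = v \<bullet> (dual_iterate z w *v v)"
      by (simp add: K_def matrix_vector_mult_def inner_vec_def sum_distrib_left ac_simps)
    finally show ?thesis .
  qed
  moreover have "dual_iterate z w \<in> sym_mats"
    unfolding dual_iterate_def
    by (intro subspace_add subspace_diff subspace_scale sym_mats_subspace C_sym adjA_sym z
        psd_coneD(1)[OF X])
  ultimately show "dual_iterate z w \<in> psd_cone" by (simp add: psd_cone_def)
qed

text \<open>The preconditioned step is the violation of the two linear KKT equations at the new
  iterate, with the dual iterate in the role of the slack.\<close>

lemma P_op_pdhg_residual:
  assumes w: "w = pdhg_step A b C \<tau> \<sigma> z"
  shows "P (w - z) = (dual_iterate z w - (C - adjA A (snd w)), b - opA A (fst w))"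
proof -
  have "snd w - snd z = \<sigma> *\<^sub>R (b - opA A (2 *\<^sub>R fst w - fst z))"
    by (simp add: w pdhg_step_def split_beta Let_def)
  then have "inverse \<sigma> *\<^sub>R (snd w - snd z) = b - opA A (2 *\<^sub>R fst w - fst z)" using \<sigma> by simp
  also have "\<dots> = b - opA A (fst w) - opA A (fst w - fst z)"
  proof -
    have "2 *\<^sub>R fst w - fst z = fst w + (fst w - fst z)" by (simp add: scaleR_2)
    then show ?thesis by (simp only: linear_add[OF linear_opA] diff_diff_eq)
  qed
  finally show ?thesis
    by (simp add: P_op_def split_beta dual_iterate_def linear_diff[OF linear_adjA])
qed

text \<open>The linear KKT equations contribute a skew-symmetric term, which cancels; what remains is
  the complementarity defect between the step and the KKT point.\<close>

lemma pdhg_residual_monotone: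
  assumes w: "w = pdhg_step A b C \<tau> \<sigma> z" and z: "fst z \<in> sym_mats"
    and KKT: "(X, y, S) \<in> KKT_set A b C"
  shows "(w - (X, y)) \<bullet> P (w - z) = - (fst w \<bullet> S + X \<bullet> dual_iterate z w)"
proof -
  have k: "opA A X = b" "S = C - adjA A y" "X \<bullet> S = 0"
    using KKT by (auto simp: KKT_set_def algebra_simps)
  have "(w - (X, y)) \<bullet> P (w - z)
     = (fst w - X) \<bullet> (dual_iterate z w - S + adjA A (snd w - y)) - opA A (fst w - X) \<bullet> (snd w - y)"
    unfolding P_op_pdhg_residual[OF w] k(2)
    by (cases w) (simp add: k(1)[symmetric] linear_diff[OF linear_opA] linear_diff[OF linear_adjA]
        inner_diff_left inner_diff_right inner_commute algebra_simps)
  also have "\<dots> = (fst w - X) \<bullet> (dual_iterate z w - S)"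
    by (simp add: opA_adjA inner_add_right)
  also have "\<dots> = - (fst w \<bullet> S + X \<bullet> dual_iterate z w)"
    using pdhg_step_complementary(3)[OF z w] k(3) by (simp add: inner_diff_left inner_diff_right)
  finally show ?thesis .
qed

text \<open>Expand \<open>z - p = (w - p) - (w - z)\<close> for the KKT point \<open>p = (X, y)\<close>: the cross term has a
  sign because the complementarity defect pairs positive semidefinite matrices.\<close>

lemma pdhg_fejer:
  assumes w: "w = pdhg_step A b C \<tau> \<sigma> z" and z: "fst z \<in> sym_mats"
    and KKT: "(X, y, S) \<in> KKT_set A b C"
  shows "(w - (X, y)) \<bullet> P (w - (X, y)) + (w - z) \<bullet> P (w - z) \<le> (z - (X, y)) \<bullet> P (z - (X, y))"
proof -
  have "X \<in> psd_cone" "S \<in> psd_cone" using KKT by (auto simp: KKT_set_def)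
  then have nonneg: "0 \<le> fst w \<bullet> S + X \<bullet> dual_iterate z w"
    by (intro add_nonneg_nonneg psd_cone_inner_nonneg pdhg_step_complementary[OF z w])
  define p q where "p = w - (X, y)" and "q = w - z"
  have "z - (X, y) = p - q" by (simp add: p_def q_def)
  then have "(z - (X, y)) \<bullet> P (z - (X, y)) = p \<bullet> P p + q \<bullet> P q - 2 * (p \<bullet> P q)"
    using P_op_selfadjoint[of p A \<tau> \<sigma> q]
    by (simp add: linear_diff[OF linear_P_op] inner_diff_left inner_diff_right)
  moreover have "p \<bullet> P q \<le> 0"
    using pdhg_residual_monotone[OF w z KKT] nonneg by (simp add: p_def q_def)
  ultimately show ?thesis unfolding p_def[symmetric] q_def[symmetric] by linarith
qed

end

section \<open>Almost diagonal blocks and off-diagonal blocks\<close>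

definition off_block :: "'n set \<Rightarrow> real^'n^'n \<Rightarrow> real^'n^'n" where
  "off_block I M = M - corner I M"

lemma off_block_entry: "off_block I M $ i $ j = (if i \<in> I \<and> j \<in> I then 0 else M $ i $ j)"
  by (simp add: off_block_def corner_def)

lemma linear_off_block: "linear (off_block I)"
  by (rule linearI) (simp_all add: vec_eq_iff off_block_entry)

lemma off_block_corner: "off_block I (corner I M) = 0"
  by (simp add: vec_eq_iff off_block_entry) (simp add: corner_def)

lemma norm_matrix_sq: "(norm (M :: real^'n^'n))\<^sup>2 = (\<Sum>i\<in>UNIV. \<Sum>j\<in>UNIV. (M $ i $ j)\<^sup>2)"
  unfolding power2_norm_eq_inner by (simp add: inner_vec_def power2_eq_square)

lemma norm_off_block_le: "norm (off_block I M) \<le> norm M"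
  by (rule power2_le_imp_le) (auto simp: norm_matrix_sq off_block_entry intro!: sum_mono)

lemma inner_corner: "M \<bullet> corner I U = (\<Sum>i\<in>I. \<Sum>j\<in>I. M $ i $ j * U $ i $ j)"
proof -
  have "M \<bullet> corner I U = (\<Sum>i\<in>UNIV. if i \<in> I then \<Sum>j\<in>UNIV. if j \<in> I then M $ i $ j * U $ i $ j else 0 else 0)"
    unfolding inner_vec_def by (intro sum.cong refl) (auto simp: corner_def intro!: sum.cong)
  then show ?thesis by (simp add: sum.If_cases)
qed

lemma psd_cone_entry_le_mean:
  assumes M: "M \<in> psd_cone"
  shows "\<bar>M $ i $ j\<bar> \<le> (M $ i $ i + M $ j $ j) / 2"
proof (rule power2_le_imp_le)
  have "(M $ i $ j)\<^sup>2 \<le> M $ i $ i * M $ j $ j" by (rule psd_cone_entry(1)[OF M])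
  also have "\<dots> \<le> ((M $ i $ i + M $ j $ j) / 2)\<^sup>2"
    using zero_le_power2[of "M $ i $ i - M $ j $ j"] by (simp add: power2_eq_square field_simps)
  finally show "\<bar>M $ i $ j\<bar>\<^sup>2 \<le> ((M $ i $ i + M $ j $ j) / 2)\<^sup>2" by simp
qed (use psd_cone_entry(2)[OF M] in \<open>simp add: add_nonneg_nonneg\<close>)

text \<open>An entry outside the block \<open>I \<times> I\<close> has at least one index outside \<open>I\<close>, so its square is at
  most \<open>B\<close> times a diagonal entry of the complementary block.\<close>

lemma norm_off_block_psd:
  fixes M :: "real^'n^'n"
  assumes M: "M \<in> psd_cone" and B: "norm M \<le> B"
  shows "norm (off_block I M) \<le> CARD('n) * sqrt (B * (\<Sum>i\<in>-I. M $ i $ i))"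
proof -
  let ?t = "\<Sum>i\<in>-I. M $ i $ i"
  have diag: "0 \<le> M $ i $ i" "M $ i $ i \<le> B" for i
    using psd_cone_entry(2)[OF M] norm_matrix_entry_le[of M i i] B by auto
  have t: "0 \<le> ?t" "i \<notin> I \<Longrightarrow> M $ i $ i \<le> ?t" for i
    using diag by (auto intro: sum_nonneg member_le_sum)
  have Bt: "0 \<le> B * ?t" using diag[of undefined] t(1) by simp
  have "(off_block I M $ i $ j)\<^sup>2 \<le> B * ?t" for i j
  proof (cases "i \<in> I \<and> j \<in> I")
    case False
    have "M $ i $ i * M $ j $ j \<le> B * ?t"
    proof (cases "j \<in> I")
      case True
      then have "M $ i $ i \<le> ?t" using False t(2) by blast
      then show ?thesis using mult_mono[OF diag(2)[of j], of "M $ i $ i" ?t] diag[of i] diag[of j]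
        by (simp add: mult.commute)
    next
      case False
      then show ?thesis using diag[of i] diag[of j] t(2)[of j] by (intro mult_mono) auto
    qed
    with psd_cone_entry(1)[OF M, of i j] False show ?thesis
      by (auto simp: off_block_entry)
  qed (use Bt in \<open>simp add: off_block_entry\<close>)
  then have "(norm (off_block I M))\<^sup>2 \<le> (\<Sum>i\<in>(UNIV :: 'n set). \<Sum>j\<in>(UNIV :: 'n set). B * ?t)"
    unfolding norm_matrix_sq by (intro sum_mono)
  also have "\<dots> = (CARD('n) * sqrt (B * ?t))\<^sup>2"
    using Bt by (simp add: power2_eq_square)
  finally show ?thesis by (rule power2_le_imp_le) (simp add: Bt)
qed

text \<open>The estimate is used for \<open>a i j = v i * v j\<close>, where it gives positive definiteness of \<open>U\<close>,
  and for the entries of a positive semidefinite matrix, where it says that pairing with \<open>U\<close>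
  controls the trace. In both cases off-diagonal values are bounded by means of diagonal ones.\<close>

lemma near_diagonal_form_lower_bound:
  fixes U D :: "real^'n^'n" and a :: "'n \<Rightarrow> 'n \<Rightarrow> real"
  assumes "\<mu> > 0" and diag: "\<And>i. i \<in> I \<Longrightarrow> \<mu> \<le> D $ i $ i" "\<And>i j. i \<in> I \<Longrightarrow> j \<in> I \<Longrightarrow> i \<noteq> j \<Longrightarrow> D $ i $ j = 0"
    and near: "\<And>i j. i \<in> I \<Longrightarrow> j \<in> I \<Longrightarrow> \<bar>U $ i $ j - D $ i $ j\<bar> \<le> \<mu> / (4 * CARD('n))"
    and a: "\<And>i j. i \<in> I \<Longrightarrow> j \<in> I \<Longrightarrow> \<bar>a i j\<bar> \<le> (a i i + a j j) / 2"
  shows "\<mu> / 2 * (\<Sum>i\<in>I. a i i) \<le> (\<Sum>i\<in>I. \<Sum>j\<in>I. a i j * U $ i $ j)"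
proof -
  define \<epsilon> where "\<epsilon> = \<mu> / (4 * CARD('n))"
  let ?T = "\<Sum>i\<in>I. a i i"
  have nonneg: "0 \<le> a i i" if "i \<in> I" for i using order_trans[OF abs_ge_zero a[OF that that]] by simp
  have T: "0 \<le> ?T" by (intro sum_nonneg nonneg)
  have \<epsilon>: "0 < \<epsilon>" "\<epsilon> * card I \<le> \<mu> / 4"
  proof -
    show "0 < \<epsilon>" using \<open>\<mu> > 0\<close> by (simp add: \<epsilon>_def)
    then have "\<epsilon> * card I \<le> \<epsilon> * CARD('n)" by (simp add: card_mono)
    then show "\<epsilon> * card I \<le> \<mu> / 4" by (simp add: \<epsilon>_def)
  qed
  have entry: "(if i = j then \<mu> * a i i else 0) - \<epsilon> * ((a i i + a j j) / 2) \<le> a i j * U $ i $ j"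
    if ij: "i \<in> I" "j \<in> I" for i j
  proof -
    have "\<bar>a i j * (U $ i $ j - D $ i $ j)\<bar> \<le> (a i i + a j j) / 2 * \<epsilon>"
      unfolding abs_mult using a[OF ij] near[OF ij] by (intro mult_mono) (auto simp: \<epsilon>_def)
    moreover have "(if i = j then \<mu> * a i i else 0) \<le> a i j * D $ i $ j"
      using mult_right_mono[OF diag(1)[OF ij(1)] nonneg[OF ij(1)]] diag(2)[OF ij]
      by (auto simp: mult.commute)
    moreover have "a i j * U $ i $ j = a i j * D $ i $ j + a i j * (U $ i $ j - D $ i $ j)"
      by (simp add: right_diff_distrib)
    ultimately show ?thesis unfolding mult.commute[of \<epsilon>] by linarith
  qed
  have "(\<Sum>i\<in>I. \<Sum>j\<in>I. (if i = j then \<mu> * a i i else 0) - \<epsilon> * ((a i i + a j j) / 2))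
      = \<mu> * ?T - \<epsilon> * card I * ?T"
    by (simp add: sum_subtractf sum.delta' sum.distrib sum_distrib_left[symmetric]
        sum_divide_distrib[symmetric] sum_distrib_left[of "real (card I)", symmetric] algebra_simps)
  moreover have "\<epsilon> * card I * ?T \<le> \<mu> / 4 * ?T" using \<epsilon>(2) T by (rule mult_right_mono)
  moreover have "(\<Sum>i\<in>I. \<Sum>j\<in>I. (if i = j then \<mu> * a i i else 0) - \<epsilon> * ((a i i + a j j) / 2))
      \<le> (\<Sum>i\<in>I. \<Sum>j\<in>I. a i j * U $ i $ j)"
    by (intro sum_mono entry)
  moreover have "0 \<le> \<mu> * ?T" using T \<open>\<mu> > 0\<close> by simp
  ultimately show ?thesis by (simp add: algebra_simps)
qed

lemma near_diagonal_pos_def_block: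
  fixes U D :: "real^'n^'n"
  assumes "\<mu> > 0" and diag: "\<And>i. i \<in> I \<Longrightarrow> \<mu> \<le> D $ i $ i" "\<And>i j. i \<in> I \<Longrightarrow> j \<in> I \<Longrightarrow> i \<noteq> j \<Longrightarrow> D $ i $ j = 0"
    and near: "\<And>i j. i \<in> I \<Longrightarrow> j \<in> I \<Longrightarrow> \<bar>U $ i $ j - D $ i $ j\<bar> \<le> \<mu> / (4 * CARD('n))"
    and sym: "U \<in> sym_mats"
  shows "pos_def_block I U"
  unfolding pos_def_block_def
proof (intro conjI ballI allI impI)
  show "U $ i $ j = U $ j $ i" for i j using sym_mats_entry[OF sym] by simp
  fix v :: "'n \<Rightarrow> real" assume "\<exists>i\<in>I. v i \<noteq> 0"
  then have "0 < (\<Sum>i\<in>I. v i * v i)"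
    by (metis (no_types, lifting) finite not_real_square_gt_zero sum_pos2 zero_le_square)
  then have "0 < \<mu> / 2 * (\<Sum>i\<in>I. v i * v i)" using \<open>\<mu> > 0\<close> by simp
  also have "\<dots> \<le> (\<Sum>i\<in>I. \<Sum>j\<in>I. (v i * v j) * U $ i $ j)"
  proof (rule near_diagonal_form_lower_bound[OF \<open>\<mu> > 0\<close> diag near])
    show "\<bar>v i * v j\<bar> \<le> (v i * v i + v j * v j) / 2" for i j
      using sum_squares_bound[of "\<bar>v i\<bar>" "\<bar>v j\<bar>"] by (simp add: abs_mult power2_eq_square)
  qed
  also have "\<dots> = (\<Sum>i\<in>I. \<Sum>j\<in>I. v i * U $ i $ j * v j)" by (simp add: ac_simps)
  finally show "0 < (\<Sum>i\<in>I. \<Sum>j\<in>I. v i * U $ i $ j * v j)" .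
qed

lemma pos_def_block_psd:
  fixes Q U :: "real^'n^'n"
  assumes "pos_def_block I U"
  shows "Q ** corner I U ** transpose Q \<in> psd_cone"
proof -
  have sym: "corner I U \<in> sym_mats"
    using assms by (auto simp: pos_def_block_def sym_mats_def corner_def transpose_def vec_eq_iff)
  have "0 \<le> v \<bullet> (corner I U *v v)" for v
  proof -
    have "v \<bullet> (corner I U *v v) = (\<chi> i j. v $ i * v $ j) \<bullet> corner I U"
      by (simp add: inner_vec_def matrix_vector_mult_def sum_distrib_left ac_simps)
    also have "\<dots> = (\<Sum>i\<in>I. \<Sum>j\<in>I. v $ i * U $ i $ j * v $ j)"
      by (simp add: inner_corner ac_simps)
    also have "\<dots> \<ge> 0"
    proof (cases "\<exists>i\<in>I. v $ i \<noteq> 0")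
      case True
      then show ?thesis using assms unfolding pos_def_block_def by (meson less_imp_le)
    qed simp
    finally show ?thesis .
  qed
  then have "corner I U \<in> psd_cone" using sym by (simp add: psd_cone_def)
  from frame_coords_psd[OF this, of "transpose Q"] show ?thesis
    by (simp add: frame_coords_def)
qed

lemma KKT_manifold_subset_KKT:
  assumes Q: "orthogonal_matrix Q" and M: "(X, y) \<in> KKT_manifold A b C Q I"
  shows "(X, y, C - adjA A y) \<in> KKT_set A b C"
proof -
  obtain U V where U: "pos_def_block I U" "X = Q ** corner I U ** transpose Q"
    and V: "pos_def_block (- I) V" "C - adjA A y = Q ** corner (- I) V ** transpose Q"
    and b: "opA A X = b"
    using M by (auto simp: KKT_manifold_def)
  have "X \<bullet> (C - adjA A y) = corner I U \<bullet> corner (- I) V"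
    using inner_frame_coords[OF Q, of X "C - adjA A y"]
    by (simp add: U(2) V(2) frame_coords_inverse(2)[OF Q])
  also have "\<dots> = 0" unfolding inner_corner by (simp add: corner_def)
  finally have "X \<bullet> (C - adjA A y) = 0" .
  moreover have "X \<in> psd_cone" "C - adjA A y \<in> psd_cone"
    using pos_def_block_psd[OF U(1)] pos_def_block_psd[OF V(1)] U(2) V(2) by simp_all
  ultimately show ?thesis using b by (simp add: KKT_set_def)
qed

section \<open>The tangent space of the KKT manifold\<close>

lemma norm_quad: "norm (0 :: 'a::real_normed_vector, p :: 'b::real_normed_vector,
    q :: 'c::real_normed_vector, r :: 'd::real_normed_vector) \<le> norm p + (norm q + norm r)"
  using norm_Pair_le[of "0 :: 'a" "(p, q, r)"] norm_Pair_le[of p "(q, r)"] norm_Pair_le[of q r]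
  by simp

text \<open>The existence of a common eigenframe encodes strict complementarity: the blocks \<open>I\<close> and
  \<open>- I\<close> on which the two matrices are positive definite exhaust the index set.\<close>

locale strict_kkt_point = sdp_pdhg A b C \<tau> \<sigma>
  for A :: "'m::finite \<Rightarrow> real^'n^'n" and b :: "real^'m" and C :: "real^'n^'n"
    and \<tau> \<sigma> :: real +
  fixes Xs Ss :: "real^'n^'n" and ys :: "real^'m" and Q :: "real^'n^'n" and I :: "'n set"
  assumes KKT: "(Xs, ys, Ss) \<in> KKT_set A b C" and frame: "common_eigenframe Xs Ss Q I"
begin

abbreviation "\<M> \<equiv> KKT_manifold A b C Q I"

lemma frame_orthogonal: "orthogonal_matrix Q" using frame by (simp add: common_eigenframe_def)

lemma KKT_eqs: "opA A Xs = b" "Ss = C - adjA A ys" "Xs \<in> sym_mats" "Ss \<in> sym_mats"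
  using KKT by (auto simp: KKT_set_def psd_cone_def algebra_simps)

lemma frame_blocks:
  obtains \<mu> where "\<mu> > 0" "\<And>i. i \<in> I \<Longrightarrow> \<mu> \<le> frame_coords Q Xs $ i $ i"
    "\<And>i. i \<in> - I \<Longrightarrow> \<mu> \<le> frame_coords Q Ss $ i $ i"
proof -
  have "\<forall>i\<in>I. 0 < frame_coords Q Xs $ i $ i" "\<forall>i\<in>-I. 0 < frame_coords Q Ss $ i $ i"
    using frame frame_orthogonal
    by (auto simp: common_eigenframe_def frame_coords_inverse(2) corner_def pos_diag_block_def)
  moreover define E where "E = insert 1
      ((\<lambda>i. frame_coords Q Xs $ i $ i) ` I \<union> (\<lambda>i. frame_coords Q Ss $ i $ i) ` (-I))"
  moreover have "finite E" "E \<noteq> {}" by (simp_all add: E_def)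
  ultimately have pos: "0 < Min E" and E: "finite E" by auto
  show ?thesis
  proof (rule that[OF pos])
    show "Min E \<le> frame_coords Q Xs $ i $ i" if "i \<in> I" for i
      by (rule Min_le[OF E]) (use that in \<open>auto simp: E_def\<close>)
    show "Min E \<le> frame_coords Q Ss $ i $ i" if "i \<in> - I" for i
      by (rule Min_le[OF E]) (use that in \<open>auto simp: E_def\<close>)
  qed
qed

lemma frame_diagonal:
  assumes "i \<noteq> j" shows "frame_coords Q Xs $ i $ j = 0" "frame_coords Q Ss $ i $ j = 0"
  using frame frame_orthogonal assms
  by (auto simp: common_eigenframe_def frame_coords_inverse(2) corner_def pos_diag_block_def)

lemma frame_off_block: "off_block I (frame_coords Q Xs) = 0" "off_block (- I) (frame_coords Q Ss) = 0"
  using frame frame_orthogonal by (auto simp: common_eigenframe_def frame_coords_inverse(2) off_block_corner)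

text \<open>The linear equations of the manifold, linearised at \<open>(Xs, ys)\<close>: symmetry, primal
  feasibility, and vanishing of the primal and the dual matrix outside of their blocks. The
  kernel is the tangent space of the manifold.\<close>

definition tangent_defect ::
  "(real^'n^'n) \<times> (real^'m) \<Rightarrow> (real^'n^'n) \<times> (real^'m) \<times> (real^'n^'n) \<times> (real^'n^'n)" where
  "tangent_defect h = (fst h - transpose (fst h), opA A (fst h),
     off_block I (frame_coords Q (fst h)), off_block (- I) (frame_coords Q (adjA A (snd h))))"

lemma linear_tangent_defect: "linear tangent_defect"
  by (rule linearI) (simp_all add: tangent_defect_def linear_add[OF linear_opA] linear_add[OF linear_adjA]
      linear_add[OF linear_frame_coords] linear_add[OF linear_off_block]
      linear_scale[OF linear_opA] linear_scale[OF linear_adjA]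
      linear_scale[OF linear_frame_coords] linear_scale[OF linear_off_block]
      vec_eq_iff transpose_def algebra_simps)

lemma manifold_tangent:
  assumes "w \<in> \<M>"
  shows "tangent_defect (w - (Xs, ys)) = 0"
proof -
  obtain X y where w: "w = (X, y)" by (cases w)
  obtain U V where U: "pos_def_block I U" "X = Q ** corner I U ** transpose Q"
    and V: "pos_def_block (- I) V" "C - adjA A y = Q ** corner (- I) V ** transpose Q"
    and b: "opA A X = b"
    using assms by (auto simp: KKT_manifold_def w)
  have "X \<in> sym_mats" using pos_def_block_psd[OF U(1)] U(2) by (simp add: psd_coneD)
  then have "X - Xs \<in> sym_mats" by (intro subspace_diff sym_mats_subspace KKT_eqs)
  moreover have "off_block I (frame_coords Q (X - Xs)) = 0"
    by (simp add: linear_diff[OF linear_frame_coords] linear_diff[OF linear_off_block]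
        frame_off_block U(2) frame_coords_inverse(2)[OF frame_orthogonal] off_block_corner)
  moreover have "adjA A (y - ys) = Ss - (C - adjA A y)"
    by (simp add: KKT_eqs linear_diff[OF linear_adjA])
  then have "off_block (- I) (frame_coords Q (adjA A (y - ys))) = 0"
    by (simp add: linear_diff[OF linear_frame_coords] linear_diff[OF linear_off_block]
        frame_off_block V(2) frame_coords_inverse(2)[OF frame_orthogonal] off_block_corner)
  ultimately show ?thesis
    by (simp add: tangent_defect_def w b KKT_eqs(1) linear_diff[OF linear_opA] sym_mats_def
        zero_prod_def)
qed

text \<open>Positive definiteness of the two blocks is an open condition, so the manifold contains a
  neighbourhood of \<open>(Xs, ys)\<close> in its tangent plane. Its size depends on a lower bound \<open>\<mu>\<close> for
  the positive eigenvalues.\<close>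

lemma in_manifold_if_near_tangent:
  assumes \<mu>: "\<mu> > 0" "\<And>i. i \<in> I \<Longrightarrow> \<mu> \<le> frame_coords Q Xs $ i $ i"
    "\<And>i. i \<in> - I \<Longrightarrow> \<mu> \<le> frame_coords Q Ss $ i $ i"
    and h: "tangent_defect h = 0"
    and small: "norm (fst h) \<le> \<mu> / (4 * CARD('n))" "norm (adjA A (snd h)) \<le> \<mu> / (4 * CARD('n))"
  shows "(Xs, ys) + h \<in> \<M>"
proof -
  let ?X = "Xs + fst h" and ?S = "C - adjA A (ys + snd h)"
  have S: "?S = Ss - adjA A (snd h)" by (simp add: KKT_eqs(2) linear_add[OF linear_adjA])
  have h0: "transpose (fst h) = fst h" "opA A (fst h) = 0" "off_block I (frame_coords Q (fst h)) = 0"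
    "off_block (- I) (frame_coords Q (adjA A (snd h))) = 0"
    using h by (auto simp: tangent_defect_def zero_prod_def)
  have corner_eq: "corner J M = M" if "off_block J M = 0" for J and M :: "real^'n^'n"
    using that by (simp add: off_block_def)
  have "frame_coords Q ?X = corner I (frame_coords Q ?X)"
    by (rule corner_eq[symmetric])
      (simp add: linear_add[OF linear_frame_coords] linear_add[OF linear_off_block] h0 frame_off_block)
  then have X: "?X = Q ** corner I (frame_coords Q ?X) ** transpose Q"
    using frame_coords_inverse(1)[OF frame_orthogonal, of ?X] by simp
  have "frame_coords Q ?S = corner (- I) (frame_coords Q ?S)" unfolding S
    by (rule corner_eq[symmetric])
      (simp add: linear_diff[OF linear_frame_coords] linear_diff[OF linear_off_block] h0 frame_off_block)
  then have V: "?S = Q ** corner (- I) (frame_coords Q ?S) ** transpose Q"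
    using frame_coords_inverse(1)[OF frame_orthogonal, of ?S] by simp
  have "pos_def_block I (frame_coords Q ?X)"
  proof (rule near_diagonal_pos_def_block[OF \<mu>(1,2)])
    show "\<bar>frame_coords Q ?X $ i $ j - frame_coords Q Xs $ i $ j\<bar> \<le> \<mu> / (4 * CARD('n))" for i j
      using small(1) norm_matrix_entry_le[of "frame_coords Q (fst h)" i j]
      by (simp add: linear_add[OF linear_frame_coords] norm_frame_coords[OF frame_orthogonal])
    show "frame_coords Q ?X \<in> sym_mats"
      using KKT_eqs(3) h0(1) by (intro frame_coords_sym subspace_add sym_mats_subspace) (auto simp: sym_mats_def)
  qed (use frame_diagonal in auto)
  moreover have "pos_def_block (- I) (frame_coords Q ?S)"
  proof (rule near_diagonal_pos_def_block[OF \<mu>(1,3)])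
    show "\<bar>frame_coords Q ?S $ i $ j - frame_coords Q Ss $ i $ j\<bar> \<le> \<mu> / (4 * CARD('n))" for i j
      using small(2) norm_matrix_entry_le[of "frame_coords Q (adjA A (snd h))" i j]
      by (simp add: S linear_diff[OF linear_frame_coords] norm_frame_coords[OF frame_orthogonal])
    show "frame_coords Q ?S \<in> sym_mats"
      by (intro frame_coords_sym subspace_diff sym_mats_subspace adjA_sym C_sym)
  qed (use frame_diagonal in auto)
  moreover have "opA A ?X = b" using h0 KKT_eqs(1) by (simp add: linear_add[OF linear_opA])
  ultimately have "(?X, ys + snd h) \<in> \<M>" unfolding KKT_manifold_def using X V by blast
  then show ?thesis by (cases h) simp
qed

lemma kkt_in_manifold: "(Xs, ys) \<in> \<M>"
proof (rule frame_blocks)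
  fix \<mu> :: real assume "\<mu> > 0" and "\<And>i. i \<in> I \<Longrightarrow> \<mu> \<le> frame_coords Q Xs $ i $ i"
    "\<And>i. i \<in> - I \<Longrightarrow> \<mu> \<le> frame_coords Q Ss $ i $ i"
  from in_manifold_if_near_tangent[OF this, of 0] show ?thesis
    by (simp add: linear_0[OF linear_tangent_defect] linear_0[OF linear_adjA] \<open>\<mu> > 0\<close> less_imp_le)
qed

text \<open>A Hoffman bound for linear equations: on the orthogonal complement of its kernel a linear
  map is bounded below.\<close>

lemma tangent_decomposition:
  obtains e where "e > 0" "\<And>h. \<exists>l u. h = l + u \<and> tangent_defect l = 0 \<and> norm l \<le> norm h
      \<and> e * norm u \<le> norm (tangent_defect h)"
proof -
  define L where "L = {l. tangent_defect l = 0}"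
  define N where "N = {u. \<forall>l\<in>L. orthogonal l u}"
  have L: "subspace L" 
    using linear_tangent_defect
    by (auto simp: L_def subspace_def linear_0 linear_add linear_scale)
  have N: "subspace N" unfolding N_def by (rule subspace_orthogonal_to_vectors)
  have "\<exists>e>0. \<forall>u\<in>N. e * norm u \<le> norm (tangent_defect u)"
  proof (rule injective_imp_isometric[OF closed_subspace[OF N] N])
    show "bounded_linear tangent_defect" using linear_tangent_defect linear_conv_bounded_linear by blast
    show "\<forall>u\<in>N. tangent_defect u = 0 \<longrightarrow> u = 0"
    proof (intro ballI impI)
      fix u assume "u \<in> N" "tangent_defect u = 0"
      then have "orthogonal u u" unfolding N_def L_def by blast
      then show "u = 0" by (simp add: orthogonal_self)
    qed
  qed
  then obtain e where e: "e > 0" "\<And>u. u \<in> N \<Longrightarrow> e * norm u \<le> norm (tangent_defect u)" by blast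
  have "\<exists>l u. h = l + u \<and> tangent_defect l = 0 \<and> norm l \<le> norm h
      \<and> e * norm u \<le> norm (tangent_defect h)" for h
  proof -
    obtain l u where lu: "l \<in> L" "\<And>w. w \<in> L \<Longrightarrow> orthogonal w u" "h = l + u"
      using orthogonal_subspace_decomp_exists[of L h] L by (metis orthogonal_commute span_eq_iff)
    have "orthogonal l u" using lu(1,2) by simp
    then have "(norm h)\<^sup>2 = (norm l)\<^sup>2 + (norm u)\<^sup>2" unfolding lu(3) by (rule norm_add_Pythagorean)
    then have "(norm l)\<^sup>2 \<le> (norm h)\<^sup>2" by simp
    then have "norm l \<le> norm h" by (rule power2_le_imp_le) simp
    moreover have "tangent_defect h = tangent_defect u"
      using lu(1,3) by (simp add: L_def linear_add[OF linear_tangent_defect])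
    moreover have "u \<in> N" using lu(2) by (simp add: N_def)
    moreover have "tangent_defect l = 0" using lu(1) unfolding L_def by (rule CollectD)
    ultimately show ?thesis using lu(3) e(2)[of u] by (intro exI[of _ l] exI[of _ u]) simp
  qed
  then show ?thesis by (rule that[OF e(1)])
qed

section \<open>The error bound\<close>

text \<open>Metric subregularity of the KKT system at a strictly complementary point. The bound \<open>B\<close> on
  the primal and dual matrix is needed to turn small diagonal entries into small rows.\<close>

lemma pdhg_error_bound:
  obtains \<eta> K where "\<eta> > 0" "K > 0"
    "\<And>z w. \<lbrakk>fst z \<in> sym_mats; w = pdhg_step A b C \<tau> \<sigma> z; norm (fst w) \<le> B;
       norm (dual_iterate z w) \<le> B; norm (w - (Xs, ys)) \<le> \<eta>\<rbrakk>
      \<Longrightarrow> \<exists>p\<in>\<M>. norm (w - p) \<le> K * norm (w - z)"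
proof -
  obtain \<mu> where \<mu>: "\<mu> > 0" "\<And>i. i \<in> I \<Longrightarrow> \<mu> \<le> frame_coords Q Xs $ i $ i"
    "\<And>i. i \<in> - I \<Longrightarrow> \<mu> \<le> frame_coords Q Ss $ i $ i"
    using frame_blocks by blast
  obtain e where e: "e > 0" "\<And>h. \<exists>l u. h = l + u \<and> tangent_defect l = 0 \<and> norm l \<le> norm h
      \<and> e * norm u \<le> norm (tangent_defect h)"
    using tangent_decomposition by blast
  obtain K0 where K0: "K0 > 0" "\<And>u. norm (P u) \<le> K0 * norm u"
    using linear_bounded_pos[OF linear_P_op[of A \<tau> \<sigma>]] by blast
  obtain La where La: "La > 0" "\<And>v. norm (adjA A v) \<le> La * norm v"
    using linear_bounded_pos[OF linear_adjA[of A]] by blast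
  define \<epsilon> where "\<epsilon> = \<mu> / (4 * CARD('n))"
  have \<epsilon>: "\<epsilon> > 0" using \<mu>(1) by (simp add: \<epsilon>_def)
  define \<eta> where "\<eta> = \<epsilon> / (1 + La)"
  have \<eta>: "\<eta> > 0" using \<epsilon> La(1) by (simp add: \<eta>_def)
  define a where "a = 2 * K0"
  define c where "c = 2 * (CARD('n) * sqrt (\<bar>B\<bar> * (2 / \<mu> * K0)))"
  define K where "K = 2 * a / e + c\<^sup>2 / e\<^sup>2"
  have K: "K > 0" using K0(1) e(1) by (auto simp: K_def a_def intro!: add_pos_nonneg)
  have "\<exists>p\<in>\<M>. norm (w - p) \<le> K * norm (w - z)"
    if z: "fst z \<in> sym_mats" and w: "w = pdhg_step A b C \<tau> \<sigma> z" and wB: "norm (fst w) \<le> B"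
      and ZB: "norm (dual_iterate z w) \<le> B" and near: "norm (w - (Xs, ys)) \<le> \<eta>" for z w
  proof -
    define Z where "Z = dual_iterate z w"
    note Z = pdhg_step_complementary[OF z w, folded Z_def]
    obtain l u where lu: "w - (Xs, ys) = l + u" "tangent_defect l = 0" "norm l \<le> norm (w - (Xs, ys))"
      "e * norm u \<le> norm (tangent_defect (w - (Xs, ys)))"
      using e(2) by blast
    have l: "norm l \<le> \<eta>" using lu(3) near by linarith
    have small: "norm (fst l) \<le> \<epsilon>" "norm (adjA A (snd l)) \<le> \<epsilon>"
    proof -
      have "(1 + La) * norm l \<le> \<epsilon>" using l La(1) by (simp add: \<eta>_def field_simps)
      moreover have "norm (fst l) \<le> norm l" "norm (snd l) \<le> norm l"
        by (metis norm_fst_le prod.collapse, metis norm_snd_le prod.collapse)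
      moreover have "La * norm (snd l) \<le> La * norm l" "0 \<le> La * norm l"
        using La(1) \<open>norm (snd l) \<le> norm l\<close> by simp_all
      moreover have "0 \<le> norm l" by simp
      ultimately show "norm (fst l) \<le> \<epsilon>" "norm (adjA A (snd l)) \<le> \<epsilon>"
        using La(2)[of "snd l"] unfolding distrib_right by linarith+
    qed
    \<comment> \<open>The comparison point keeps the tangential part of the error, so that \<open>w - p\<close> is
      controlled by the defect.\<close>
    define p where "p = (Xs, ys) + l"
    have p: "p \<in> \<M>" unfolding p_def
      by (rule in_manifold_if_near_tangent[OF \<mu> lu(2) small[unfolded \<epsilon>_def]])
    have wp: "w - p = u" using lu(1) by (simp add: p_def algebra_simps)
    obtain Xp yp where pe: "p = (Xp, yp)" by (cases p)
    define Sp where "Sp = C - adjA A yp"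
    have KKTp: "(Xp, yp, Sp) \<in> KKT_set A b C"
      using KKT_manifold_subset_KKT[OF frame_orthogonal] p by (simp add: pe Sp_def)
    obtain U V where U: "Xp = Q ** corner I U ** transpose Q"
      and V: "Sp = Q ** corner (- I) V ** transpose Q"
      using p by (auto simp: KKT_manifold_def pe Sp_def)
    have "Xp = fst p" "yp = snd p" by (simp_all add: pe)
    then have Xp: "Xp = Xs + fst l" "Sp = Ss - adjA A (snd l)"
      by (simp_all add: p_def Sp_def KKT_eqs(2) linear_add[OF linear_adjA])
    define X' Z' where "X' = frame_coords Q (fst w)" and "Z' = frame_coords Q Z"
    have psd': "X' \<in> psd_cone" "Z' \<in> psd_cone" using Z by (simp_all add: X'_def Z'_def frame_coords_psd)
    define tX tZ where "tX = (\<Sum>i\<in>-I. X' $ i $ i)" and "tZ = (\<Sum>i\<in>I. Z' $ i $ i)"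
    have t: "0 \<le> tX" "0 \<le> tZ" unfolding tX_def tZ_def using psd_cone_entry(2) psd' by (auto intro: sum_nonneg)
    have "\<mu> / 2 * tX \<le> fst w \<bullet> Sp"
    proof -
      have "fst w \<bullet> Sp = X' \<bullet> corner (- I) V"
        unfolding X'_def inner_frame_coords[OF frame_orthogonal, of "fst w" Sp, symmetric]
        by (simp add: V frame_coords_inverse(2)[OF frame_orthogonal])
      also have "corner (- I) V = frame_coords Q Sp" by (simp add: V frame_coords_inverse(2)[OF frame_orthogonal])
      also have "\<dots> = corner (- I) (frame_coords Q Sp)"
        by (simp add: V frame_coords_inverse(2)[OF frame_orthogonal]) (simp add: corner_def vec_eq_iff)
      also have "X' \<bullet> \<dots> = (\<Sum>i\<in>-I. \<Sum>j\<in>-I. X' $ i $ j * frame_coords Q Sp $ i $ j)"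
        by (rule inner_corner)
      also have "\<dots> \<ge> \<mu> / 2 * tX" unfolding tX_def
      proof (rule near_diagonal_form_lower_bound[OF \<mu>(1) \<mu>(3)])
        show "\<bar>frame_coords Q Sp $ i $ j - frame_coords Q Ss $ i $ j\<bar> \<le> \<mu> / (4 * CARD('n))" for i j
          using small(2) norm_matrix_entry_le[of "frame_coords Q (adjA A (snd l))" i j]
          by (simp add: Xp \<epsilon>_def linear_diff[OF linear_frame_coords] norm_frame_coords[OF frame_orthogonal])
      qed (use frame_diagonal psd_cone_entry_le_mean[OF psd'(1)] in auto)
      finally show ?thesis .
    qed
    moreover have "\<mu> / 2 * tZ \<le> Xp \<bullet> Z"
    proof -
      have "Xp \<bullet> Z = Z' \<bullet> corner I U"
        unfolding Z'_def inner_commute[of Xp] inner_frame_coords[OF frame_orthogonal, of Z Xp, symmetric]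
        by (simp add: U frame_coords_inverse(2)[OF frame_orthogonal])
      also have "corner I U = frame_coords Q Xp" by (simp add: U frame_coords_inverse(2)[OF frame_orthogonal])
      also have "\<dots> = corner I (frame_coords Q Xp)"
        by (simp add: U frame_coords_inverse(2)[OF frame_orthogonal]) (simp add: corner_def vec_eq_iff)
      also have "Z' \<bullet> \<dots> = (\<Sum>i\<in>I. \<Sum>j\<in>I. Z' $ i $ j * frame_coords Q Xp $ i $ j)"
        by (rule inner_corner)
      also have "\<dots> \<ge> \<mu> / 2 * tZ" unfolding tZ_def
      proof (rule near_diagonal_form_lower_bound[OF \<mu>(1) \<mu>(2)])
        show "\<bar>frame_coords Q Xp $ i $ j - frame_coords Q Xs $ i $ j\<bar> \<le> \<mu> / (4 * CARD('n))" for i j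
          using small(1) norm_matrix_entry_le[of "frame_coords Q (fst l)" i j]
          by (simp add: Xp \<epsilon>_def linear_add[OF linear_frame_coords] norm_frame_coords[OF frame_orthogonal])
      qed (use frame_diagonal psd_cone_entry_le_mean[OF psd'(2)] in auto)
      finally show ?thesis .
    qed
    moreover define d \<delta> where "d = norm u" and "\<delta> = norm (w - z)"
    have nn: "0 \<le> d" "0 \<le> \<delta>" by (simp_all add: d_def \<delta>_def)
    have "fst w \<bullet> Sp + Xp \<bullet> Z = - (u \<bullet> P (w - z))"
      using pdhg_residual_monotone[OF w z KKTp] wp by (simp add: pe Z_def)
    moreover have "- (u \<bullet> P (w - z)) \<le> d * (K0 * \<delta>)"
    proof -
      have "- (u \<bullet> P (w - z)) \<le> norm u * norm (P (w - z))"
        using norm_cauchy_schwarz[of "- u" "P (w - z)"] by simp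
      also have "\<dots> \<le> d * (K0 * \<delta>)" unfolding d_def \<delta>_def by (intro mult_left_mono K0) simp
      finally show ?thesis .
    qed
    ultimately have "\<mu> / 2 * (tX + tZ) \<le> d * (K0 * \<delta>)" by (simp add: distrib_left)
    then have "tX + tZ \<le> 2 / \<mu> * K0 * (d * \<delta>)" using \<mu>(1) by (simp add: field_simps)
    then have t_le: "tX \<le> 2 / \<mu> * K0 * (d * \<delta>)" "tZ \<le> 2 / \<mu> * K0 * (d * \<delta>)" using t by linarith+
    have B: "0 \<le> B" using wB norm_ge_zero order_trans by blast
    have root: "CARD('n) * sqrt (B * s) \<le> c / 2 * sqrt (d * \<delta>)" if "s \<le> 2 / \<mu> * K0 * (d * \<delta>)" for s
    proof -
      have "B * s \<le> B * (2 / \<mu> * K0) * (d * \<delta>)" using mult_left_mono[OF that B] by (simp add: mult.assoc)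
      then have "sqrt (B * s) \<le> sqrt (B * (2 / \<mu> * K0)) * sqrt (d * \<delta>)"
        unfolding real_sqrt_mult[symmetric] by (rule real_sqrt_le_mono)
      then show ?thesis using B by (simp add: c_def mult.assoc)
    qed
    have offX: "norm (off_block I X') \<le> c / 2 * sqrt (d * \<delta>)"
      using norm_off_block_psd[OF psd'(1), of B I] root[OF t_le(1)] wB
      by (simp add: X'_def norm_frame_coords[OF frame_orthogonal] tX_def)
    have offZ: "norm (off_block (- I) Z') \<le> c / 2 * sqrt (d * \<delta>)"
      using norm_off_block_psd[OF psd'(2), of B "- I"] root[OF t_le(2)] ZB
      by (simp add: Z'_def norm_frame_coords[OF frame_orthogonal] tZ_def Z_def)
    define R where "R = P (w - z)"
    have R: "fst R = Z - (C - adjA A (snd w))" "snd R = b - opA A (fst w)"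
      using P_op_pdhg_residual[OF w] by (simp_all add: R_def Z_def)
    have "norm R \<le> K0 * \<delta>" unfolding R_def \<delta>_def by (rule K0)
    then have Rn: "norm (fst R) \<le> K0 * \<delta>" "norm (snd R) \<le> K0 * \<delta>"
      by (metis norm_fst_le order_trans prod.collapse, metis \<open>norm R \<le> K0 * \<delta>\<close> norm_snd_le order_trans prod.collapse)
    have "fst (w - (Xs, ys)) - transpose (fst (w - (Xs, ys))) = 0"
    proof -
      have "fst w - Xs \<in> sym_mats"
        using psd_coneD(1)[OF Z(1)] KKT_eqs(3) by (intro subspace_diff sym_mats_subspace)
      then show ?thesis by (simp add: sym_mats_def)
    qed
    moreover have "opA A (fst (w - (Xs, ys))) = - snd R"
      by (simp add: R linear_diff[OF linear_opA] KKT_eqs(1))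
    moreover have "off_block I (frame_coords Q (fst (w - (Xs, ys)))) = off_block I X'"
      by (simp add: X'_def linear_diff[OF linear_frame_coords] linear_diff[OF linear_off_block] frame_off_block)
    moreover have "off_block (- I) (frame_coords Q (adjA A (snd (w - (Xs, ys)))))
        = off_block (- I) (frame_coords Q (fst R)) - off_block (- I) Z'"
    proof -
      have "adjA A (snd (w - (Xs, ys))) = Ss + fst R - Z"
        by (simp add: R KKT_eqs(2) linear_diff[OF linear_adjA])
      then show ?thesis
        by (simp add: Z'_def linear_diff[OF linear_frame_coords] linear_diff[OF linear_off_block]
          linear_add[OF linear_frame_coords] linear_add[OF linear_off_block] frame_off_block)
    qed
    ultimately have "tangent_defect (w - (Xs, ys)) = (0, - snd R, off_block I X',
        off_block (- I) (frame_coords Q (fst R)) - off_block (- I) Z')"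
      by (simp only: tangent_defect_def)
    then have "norm (tangent_defect (w - (Xs, ys))) \<le> norm (- snd R) + (norm (off_block I X')
        + norm (off_block (- I) (frame_coords Q (fst R)) - off_block (- I) Z'))"
      using norm_quad[of "- snd R" "off_block I X'"] by simp
    moreover have "norm (off_block (- I) (frame_coords Q (fst R)) - off_block (- I) Z')
        \<le> K0 * \<delta> + c / 2 * sqrt (d * \<delta>)"
      using norm_triangle_ineq4[of "off_block (- I) (frame_coords Q (fst R))" "off_block (- I) Z'"]
        norm_off_block_le[of "- I" "frame_coords Q (fst R)"] norm_frame_coords[OF frame_orthogonal, of "fst R"] offZ Rn(1)
      by linarith
    ultimately have "norm (tangent_defect (w - (Xs, ys))) \<le> a * \<delta> + c * sqrt (d * \<delta>)"
      using offX Rn(2) by (simp add: a_def)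
    then have main: "e * d \<le> a * \<delta> + c * sqrt (d * \<delta>)" using lu(4) by (simp add: d_def)
    \<comment> \<open>The square root is absorbed by the arithmetic-geometric mean inequality, at the price of
      half of the left-hand side.\<close>
    have "c * sqrt (d * \<delta>) = sqrt (e * d) * (c * sqrt (\<delta> / e))"
      using e(1) by (simp add: real_sqrt_mult real_sqrt_divide)
    also have "\<dots> \<le> ((sqrt (e * d))\<^sup>2 + (c * sqrt (\<delta> / e))\<^sup>2) / 2"
      using sum_squares_bound[of "sqrt (e * d)" "c * sqrt (\<delta> / e)"] by simp
    also have "\<dots> = e * d / 2 + c\<^sup>2 * \<delta> / (2 * e)"
      using e(1) nn by (simp add: power_mult_distrib add_divide_distrib)
    finally have "e * d / 2 \<le> a * \<delta> + c\<^sup>2 * \<delta> / (2 * e)" using main by linarith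
    then have "d \<le> 2 / e * (a * \<delta> + c\<^sup>2 * \<delta> / (2 * e))" using e(1) by (simp add: field_simps)
    also have "\<dots> = K * \<delta>" using e(1) by (simp add: K_def power2_eq_square field_simps)
    finally show ?thesis using p wp by (auto simp: d_def \<delta>_def)
  qed
  then show ?thesis using that \<eta> K by blast
qed

lemma manifold_KKT:
  assumes "(X, y) \<in> \<M>"
  shows "(X, y, C - adjA A y) \<in> KKT_set A b C" "X \<in> sym_mats"
  using KKT_manifold_subset_KKT[OF frame_orthogonal assms] by (auto simp: KKT_set_def psd_cone_def)

lemma P_dist_le: "P_dist A \<tau> \<sigma> z \<M> \<le> P_norm A \<tau> \<sigma> (z - p)"
  if "p \<in> \<M>" "fst z \<in> sym_mats"
  unfolding P_dist_def
proof (rule cINF_lower[OF _ that(1)])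
  show "bdd_below ((\<lambda>p. P_norm A \<tau> \<sigma> (z - p)) ` \<M>)"
  proof (rule bdd_belowI2)
    fix p assume "p \<in> \<M>"
    then have "fst (z - p) \<in> sym_mats"
      using manifold_KKT(2)[of "fst p" "snd p"] that(2) by (simp add: subspace_diff[OF sym_mats_subspace])
    then show "0 \<le> P_norm A \<tau> \<sigma> (z - p)" by (rule P_norm_sq(2))
  qed
qed

lemma P_dist_greatest: "r \<le> P_dist A \<tau> \<sigma> z \<M>" if "\<And>p. p \<in> \<M> \<Longrightarrow> r \<le> P_norm A \<tau> \<sigma> (z - p)"
  unfolding P_dist_def using kkt_in_manifold that by (intro cINF_greatest) auto

text \<open>A second point of the manifold would give a nonzero tangent direction, and moving a little
  along it would stay in the KKT set.\<close>

lemma isolated_manifold: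
  assumes "(Xs, ys, Ss) isolated_in KKT_set A b C"
  shows "\<M> = {(Xs, ys)}"
proof (rule ccontr)
  assume "\<M> \<noteq> {(Xs, ys)}"
  then obtain p where p: "p \<in> \<M>" "p \<noteq> (Xs, ys)" using kkt_in_manifold by blast
  define h where "h = p - (Xs, ys)"
  have h: "h \<noteq> 0" "tangent_defect h = 0" using p manifold_tangent[OF p(1)] by (auto simp: h_def)
  obtain T where T: "open T" "T \<inter> KKT_set A b C = {(Xs, ys, Ss)}"
    using assms by (auto simp: isolated_in_def)
  obtain \<mu> where \<mu>: "\<mu> > 0" "\<And>i. i \<in> I \<Longrightarrow> \<mu> \<le> frame_coords Q Xs $ i $ i"
    "\<And>i. i \<in> - I \<Longrightarrow> \<mu> \<le> frame_coords Q Ss $ i $ i"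
    using frame_blocks by blast
  define \<epsilon> where "\<epsilon> = \<mu> / (4 * CARD('n))"
  have \<epsilon>: "\<epsilon> > 0" using \<mu>(1) by (simp add: \<epsilon>_def)
  define g where "g t = (Xs + t *\<^sub>R fst h, ys + t *\<^sub>R snd h, Ss - t *\<^sub>R adjA A (snd h))" for t
  have "(g \<longlongrightarrow> g 0) (at_right 0)" unfolding g_def by (intro tendsto_intros)
  moreover have "g 0 \<in> T" using T(2) by (auto simp: g_def)
  ultimately have "\<forall>\<^sub>F t in at_right 0. g t \<in> T" using T(1) topological_tendstoD by blast
  moreover have "((\<lambda>t. norm (t *\<^sub>R fst h)) \<longlongrightarrow> norm (0 *\<^sub>R fst h)) (at_right 0)"
    "((\<lambda>t. norm (t *\<^sub>R adjA A (snd h))) \<longlongrightarrow> norm (0 *\<^sub>R adjA A (snd h))) (at_right 0)"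
    by (intro tendsto_intros)+
  then have "\<forall>\<^sub>F t in at_right 0. norm (t *\<^sub>R fst h) < \<epsilon>"
    "\<forall>\<^sub>F t in at_right 0. norm (t *\<^sub>R adjA A (snd h)) < \<epsilon>"
    using \<epsilon> by (auto elim: order_tendstoD(2))
  moreover have "\<forall>\<^sub>F t in at_right (0::real). 0 < t" by (simp add: eventually_at_right_less)
  ultimately have "\<forall>\<^sub>F t in at_right 0. g t \<in> T \<and> norm (t *\<^sub>R fst h) < \<epsilon> \<and>
      norm (t *\<^sub>R adjA A (snd h)) < \<epsilon> \<and> 0 < t"
    by eventually_elim simp
  then obtain t where t: "g t \<in> T" "norm (t *\<^sub>R fst h) < \<epsilon>" "norm (t *\<^sub>R adjA A (snd h)) < \<epsilon>" "0 < t"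
    using eventually_happens'[OF trivial_limit_at_right_real] by blast
  have "(Xs, ys) + t *\<^sub>R h \<in> \<M>"
    using t(2,3) h(2) by (intro in_manifold_if_near_tangent[OF \<mu>, folded \<epsilon>_def])
      (simp_all add: linear_scale[OF linear_tangent_defect] linear_scale[OF linear_adjA])
  then have "(Xs + t *\<^sub>R fst h, ys + t *\<^sub>R snd h) \<in> \<M>" by (cases h) simp
  from manifold_KKT(1)[OF this] have "g t \<in> KKT_set A b C"
    by (simp add: g_def KKT_eqs(2) linear_add[OF linear_adjA] linear_scale[OF linear_adjA] diff_diff_eq)
  then have "g t = (Xs, ys, Ss)" using T(2) t(1) by blast
  then have "h = 0" using t(4) by (simp add: g_def prod_eq_iff)
  then show False using h(1) by simp
qed

end

section \<open>Contraction of the distance to the KKT manifold\<close>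

locale strict_pdhg_run = strict_kkt_point A b C \<tau> \<sigma> Xs Ss ys Q I
  for A :: "'m::finite \<Rightarrow> real^'n^'n" and b C \<tau> \<sigma> Xs Ss ys Q I +
  fixes z :: "nat \<Rightarrow> (real^'n^'n) \<times> (real^'m)"
  assumes init: "fst (z 0) \<in> sym_mats"
    and run: "\<And>k. z (Suc k) = pdhg_step A b C \<tau> \<sigma> (z k)"
    and lim: "z \<longlonglongrightarrow> (Xs, ys)"
begin

abbreviation "D k \<equiv> P_dist A \<tau> \<sigma> (z k) \<M>"

lemma iterate_sym: "fst (z k) \<in> sym_mats"
proof (induction k)
  case (Suc k)
  show ?case using pdhg_step_complementary(1)[OF Suc run] by (simp add: psd_coneD)
qed (rule init)

lemma diff_sym: "fst (z j - z k) \<in> sym_mats" "p \<in> \<M> \<Longrightarrow> fst (z k - p) \<in> sym_mats"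
  using iterate_sym manifold_KKT(2)[of "fst p" "snd p"]
  by (simp_all add: subspace_diff[OF sym_mats_subspace])

lemma fejer:
  assumes p: "p \<in> \<M>"
  shows "(P_norm A \<tau> \<sigma> (z (Suc k) - p))\<^sup>2 + (P_norm A \<tau> \<sigma> (z (Suc k) - z k))\<^sup>2
    \<le> (P_norm A \<tau> \<sigma> (z k - p))\<^sup>2"
  unfolding P_norm_sq(1)[OF diff_sym(2)[OF p]] P_norm_sq(1)[OF diff_sym(1)]
  using pdhg_fejer[OF run iterate_sym, of "fst p" "snd p" "C - adjA A (snd p)"]
    manifold_KKT(1)[of "fst p" "snd p"] p by simp


lemma step_le_dist: "P_norm A \<tau> \<sigma> (z (Suc k) - z k) \<le> D k"
proof (rule P_dist_greatest)
  fix p assume p: "p \<in> \<M>"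
  have "(P_norm A \<tau> \<sigma> (z (Suc k) - z k))\<^sup>2 \<le> (P_norm A \<tau> \<sigma> (z k - p))\<^sup>2"
    using fejer[OF p, of k] zero_le_power2[of "P_norm A \<tau> \<sigma> (z (Suc k) - p)"] by linarith
  then show "P_norm A \<tau> \<sigma> (z (Suc k) - z k) \<le> P_norm A \<tau> \<sigma> (z k - p)"
    by (rule power2_le_imp_le) (rule P_norm_sq(2)[OF diff_sym(2)[OF p]])
qed

lemma dist_nonneg: "0 \<le> D k"
  by (rule P_dist_greatest) (rule P_norm_sq(2)[OF diff_sym(2)])

lemma P_norm_decreasing:
  assumes p: "p \<in> \<M>" and "k \<le> m"
  shows "P_norm A \<tau> \<sigma> (z m - p) \<le> P_norm A \<tau> \<sigma> (z k - p)"
  using \<open>k \<le> m\<close>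
proof (induction m rule: dec_induct)
  case (step m)
  have "(P_norm A \<tau> \<sigma> (z (Suc m) - p))\<^sup>2 \<le> (P_norm A \<tau> \<sigma> (z m - p))\<^sup>2"
    using fejer[OF p, of m] zero_le_power2[of "P_norm A \<tau> \<sigma> (z (Suc m) - z m)"] by linarith
  then have "P_norm A \<tau> \<sigma> (z (Suc m) - p) \<le> P_norm A \<tau> \<sigma> (z m - p)"
    by (rule power2_le_imp_le) (rule P_norm_sq(2)[OF diff_sym(2)[OF p]])
  then show ?case using step.IH by linarith
qed simp

text \<open>Distances to points of the manifold decrease along the run, and the limit inherits this.\<close>

lemma P_norm_limit_le:
  assumes p: "p \<in> \<M>"
  shows "P_norm A \<tau> \<sigma> ((Xs, ys) - p) \<le> P_norm A \<tau> \<sigma> (z k - p)"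
proof (rule LIMSEQ_le_const2)
  have "((\<lambda>m. P (z m - p)) \<longlonglongrightarrow> P ((Xs, ys) - p))"
    by (intro bounded_linear.tendsto[OF linear_conv_bounded_linear[THEN iffD1, OF linear_P_op]]
        tendsto_intros lim)
  then show "(\<lambda>m. P_norm A \<tau> \<sigma> (z m - p)) \<longlonglongrightarrow> P_norm A \<tau> \<sigma> ((Xs, ys) - p)"
    unfolding P_norm_def by (intro tendsto_intros lim)
  show "\<exists>N. \<forall>m\<ge>N. P_norm A \<tau> \<sigma> (z m - p) \<le> P_norm A \<tau> \<sigma> (z k - p)"
    using P_norm_decreasing[OF p] by blast
qed

text \<open>For a point \<open>p\<close> of the manifold, both the iterate and the limit are within \<open>\<parallel>z k - p\<parallel>\<close> of
  \<open>p\<close>; take the infimum over \<open>p\<close>.\<close>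

lemma dist_to_limit_le:
  obtains G where "G > 0" "\<And>k. norm (z (Suc k) - z k) \<le> G * D k" "\<And>k. norm (z k - (Xs, ys)) \<le> G * D k"
proof (rule P_norm_equiv)
  fix c K :: real assume c: "c > 0" "\<And>u. fst u \<in> sym_mats \<Longrightarrow> c * norm u \<le> P_norm A \<tau> \<sigma> u"
  have "norm (z (Suc k) - z k) \<le> 2 / c * D k" for k
  proof -
    have "c * norm (z (Suc k) - z k) \<le> D k"
      using c(2)[OF diff_sym(1)] step_le_dist order_trans by blast
    then show ?thesis using c(1) dist_nonneg[of k] by (simp add: field_simps)
  qed
  moreover have "norm (z k - (Xs, ys)) \<le> 2 / c * D k" for k
  proof -
    have "c / 2 * norm (z k - (Xs, ys)) \<le> D k"
    proof (rule P_dist_greatest)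
      fix p assume p: "p \<in> \<M>"
      have sym: "fst ((Xs, ys) - p) \<in> sym_mats"
        using manifold_KKT(2)[of "fst p" "snd p"] p KKT_eqs(3)
        by (simp add: subspace_diff[OF sym_mats_subspace])
      have "norm (z k - (Xs, ys)) \<le> norm (z k - p) + norm ((Xs, ys) - p)"
        using norm_triangle_ineq4[of "z k - p" "(Xs, ys) - p"] by (simp add: algebra_simps)
      then have "c * norm (z k - (Xs, ys)) \<le> c * norm (z k - p) + c * norm ((Xs, ys) - p)"
        using c(1) by (simp flip: distrib_left)
      also have "\<dots> \<le> 2 * P_norm A \<tau> \<sigma> (z k - p)"
        using c(2)[OF diff_sym(2)[OF p], of k] c(2)[OF sym] P_norm_limit_le[OF p, of k] by linarith
      finally show "c / 2 * norm (z k - (Xs, ys)) \<le> P_norm A \<tau> \<sigma> (z k - p)" by simp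
    qed
    then show ?thesis using c(1) by (simp add: field_simps)
  qed
  ultimately show ?thesis using that[of "2 / c"] c(1) by simp
qed

text \<open>The error bound makes the term \<open>\<parallel>z (Suc k) - z k\<parallel>\<close> in the Fejer inequality at least \<open>H\<close>
  times the new distance, which gives the ratio \<open>1 / sqrt (1 + H\<^sup>2)\<close>.\<close>

lemma dist_contraction:
  obtains \<rho> k0 where "0 < \<rho>" "\<rho> < 1" "\<And>k. k \<ge> k0 \<Longrightarrow> D (Suc k) \<le> \<rho> * D k"
proof -
  have z_bounded: "Bseq z" using lim convergent_imp_Bseq convergent_def by blast
  have "(\<lambda>k. dual_iterate (z k) (z (Suc k))) \<longlonglongrightarrow> inverse \<tau> *\<^sub>R (Xs - Xs) + (C - adjA A ys)"
    unfolding dual_iterate_def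
    using tendsto_fst[OF lim] tendsto_snd[OF lim] LIMSEQ_Suc[OF tendsto_fst[OF lim]]
    by (intro tendsto_intros bounded_linear.tendsto[OF linear_conv_bounded_linear[THEN iffD1, OF linear_adjA]])
      simp_all
  then have "Bseq (\<lambda>k. dual_iterate (z k) (z (Suc k)))"
    using convergent_imp_Bseq convergent_def by blast
  then obtain B1 where B1: "\<And>k. norm (dual_iterate (z k) (z (Suc k))) \<le> B1" by (auto simp: Bseq_def)
  obtain B2 where B2: "\<And>k. norm (z k) \<le> B2" using z_bounded by (auto simp: Bseq_def)
  define B where "B = max B1 B2"
  have B: "norm (fst (z k)) \<le> B" "norm (dual_iterate (z k) (z (Suc k))) \<le> B" for k
    using B1[of k] B2[of k] norm_fst_le[of "fst (z k)" "snd (z k)"] by (auto simp: B_def)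
  obtain \<eta> K where \<eta>: "\<eta> > 0" and K: "K > 0"
    and eb: "\<And>z w. \<lbrakk>fst z \<in> sym_mats; w = pdhg_step A b C \<tau> \<sigma> z; norm (fst w) \<le> B;
       norm (dual_iterate z w) \<le> B; norm (w - (Xs, ys)) \<le> \<eta>\<rbrakk>
      \<Longrightarrow> \<exists>p\<in>\<M>. norm (w - p) \<le> K * norm (w - z)"
    by (rule pdhg_error_bound[where B = B]) (rule that; blast)
  obtain c L where c: "c > 0" "\<And>u. fst u \<in> sym_mats \<Longrightarrow> c * norm u \<le> P_norm A \<tau> \<sigma> u"
    and L: "L > 0" "\<And>u. fst u \<in> sym_mats \<Longrightarrow> P_norm A \<tau> \<sigma> u \<le> L * norm u"
    by (rule P_norm_equiv) (rule that; blast)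
  define H where "H = c / (L * K)"
  have H: "H > 0" using c(1) L(1) K by (simp add: H_def)
  define \<rho> where "\<rho> = 1 / sqrt (1 + H\<^sup>2)"
  have "sqrt (1 + H\<^sup>2) > 1" using H by simp
  then have sq: "sqrt (1 + H\<^sup>2) > 1" "0 < sqrt (1 + H\<^sup>2)" by linarith+
  have "\<forall>\<^sub>F k in sequentially. dist (z k) (Xs, ys) < \<eta>" using lim \<eta> by (rule tendstoD)
  then obtain k0 where k0: "\<And>k. k \<ge> k0 \<Longrightarrow> norm (z k - (Xs, ys)) < \<eta>"
    by (auto simp: eventually_sequentially dist_norm)
  have "D (Suc k) \<le> \<rho> * D k" if "k \<ge> k0" for k
  proof -
    have "norm (z (Suc k) - (Xs, ys)) \<le> \<eta>" using k0[of "Suc k"] that by simp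
    then obtain q where q: "q \<in> \<M>" "norm (z (Suc k) - q) \<le> K * norm (z (Suc k) - z k)"
      by (rule bexE[OF eb[OF iterate_sym run B(1) B(2)]])
    have "D (Suc k) \<le> P_norm A \<tau> \<sigma> (z (Suc k) - q)" by (rule P_dist_le[OF q(1) iterate_sym])
    also have "\<dots> \<le> L * norm (z (Suc k) - q)" by (rule L(2)[OF diff_sym(2)[OF q(1)]])
    also have "\<dots> \<le> L * (K * norm (z (Suc k) - z k))" using q(2) L(1) by simp
    finally have "c * D (Suc k) \<le> L * K * (c * norm (z (Suc k) - z k))"
      using c(1) by (simp add: ac_simps)
    also have "\<dots> \<le> L * K * P_norm A \<tau> \<sigma> (z (Suc k) - z k)"
      using c(2)[OF diff_sym(1)] L(1) K by (intro mult_left_mono) simp_all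
    finally have HD: "H * D (Suc k) \<le> P_norm A \<tau> \<sigma> (z (Suc k) - z k)"
      using L(1) K by (simp add: H_def field_simps)
    have "sqrt (1 + H\<^sup>2) * D (Suc k) \<le> D k"
    proof (rule P_dist_greatest, rule power2_le_imp_le)
      fix p assume p: "p \<in> \<M>"
      have "(sqrt (1 + H\<^sup>2) * D (Suc k))\<^sup>2 = (D (Suc k))\<^sup>2 + (H * D (Suc k))\<^sup>2"
        by (simp add: power_mult_distrib distrib_right)
      also have "\<dots> \<le> (P_norm A \<tau> \<sigma> (z (Suc k) - p))\<^sup>2 + (P_norm A \<tau> \<sigma> (z (Suc k) - z k))\<^sup>2"
        using H HD dist_nonneg[of "Suc k"] P_dist_le[OF p iterate_sym]
        by (intro add_mono power_mono) simp_all
      also have "\<dots> \<le> (P_norm A \<tau> \<sigma> (z k - p))\<^sup>2" by (rule fejer[OF p])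
      finally show "(sqrt (1 + H\<^sup>2) * D (Suc k))\<^sup>2 \<le> (P_norm A \<tau> \<sigma> (z k - p))\<^sup>2" .
      show "0 \<le> P_norm A \<tau> \<sigma> (z k - p)" by (rule P_norm_sq(2)[OF diff_sym(2)[OF p]])
    qed
    then have "D (Suc k) \<le> D k / sqrt (1 + H\<^sup>2)"
      using sq(2) by (simp only: pos_le_divide_eq mult.commute[of "D (Suc k)"])
    then show ?thesis by (simp add: \<rho>_def)
  qed
  moreover have "0 < \<rho>" "\<rho> < 1"
    unfolding \<rho>_def using sq by (simp_all only: zero_less_divide_1_iff divide_less_eq_1_pos)
  ultimately show ?thesis using that by blast
qed

end

section \<open>Linear convergence\<close>

theorem theorem1:
  fixes A :: "'m::finite \<Rightarrow> real^'n^'n" and b :: "real^'m" and C :: "real^'n^'n"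
    and \<tau> \<sigma> :: real
    and X S :: "nat \<Rightarrow> real^'n^'n" and y :: "nat \<Rightarrow> real^'m"
    and Xs Ss :: "real^'n^'n" and ys :: "real^'m"
  assumes C_sym: "C \<in> sym_mats" and A_sym: "\<And>i. A i \<in> sym_mats"
    and surj: "opA A ` sym_mats = UNIV"
    and KKT_nonempty: "KKT_set A b C \<noteq> {}"
    and step_sizes: "\<tau> > 0" "\<sigma> > 0" "\<tau> * \<sigma> * (opA_norm A)\<^sup>2 < 1"
    and init: "X 0 \<in> sym_mats"
    and pdhg: "\<And>k. (X (Suc k), y (Suc k)) = pdhg_step A b C \<tau> \<sigma> (X k, y k)"
    and slack: "\<And>k. S k = C - adjA A (y k)"
    and conv: "(\<lambda>k. (X k, y k, S k)) \<longlonglongrightarrow> (Xs, ys, Ss)"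
    and KKT_limit: "(Xs, ys, Ss) \<in> KKT_set A b C"
    and strict_compl: "rank Xs + rank Ss = CARD('n)"
  shows "(\<exists>Q I. common_eigenframe Xs Ss Q I) \<and>
    (\<forall>Q I. common_eigenframe Xs Ss Q I \<longrightarrow>
      (\<exists>\<rho> k0. 0 < \<rho> \<and> \<rho> < 1 \<and>
        (\<forall>k\<ge>k0. P_dist A \<tau> \<sigma> (X (Suc k), y (Suc k)) (KKT_manifold A b C Q I)
            \<le> \<rho> * P_dist A \<tau> \<sigma> (X k, y k) (KKT_manifold A b C Q I)) \<and>
        (\<exists>\<kappa>>0. \<forall>k\<ge>k0.
          P_dist A \<tau> \<sigma> (X k, y k) (KKT_manifold A b C Q I) \<le> \<kappa> * \<rho> ^ (k - k0) \<and>
          infdist (X k, y k, S k) (KKT_set A b C) \<le> \<kappa> * \<rho> ^ (k - k0) \<and>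
          norm (X (Suc k) - X k) + norm (y (Suc k) - y k) + norm (S (Suc k) - S k)
            \<le> \<kappa> * \<rho> ^ (k - k0) \<and>
          norm (X k - Xs) + norm (y k - ys) + norm (S k - Ss) \<le> \<kappa> * \<rho> ^ (k - k0)))) \<and>
    ((Xs, ys, Ss) isolated_in KKT_set A b C \<longrightarrow>
      (\<exists>\<rho>. 0 < \<rho> \<and> \<rho> < 1 \<and>
        (\<forall>\<^sub>F k in sequentially. P_norm A \<tau> \<sigma> ((X (Suc k), y (Suc k)) - (Xs, ys))
            \<le> \<rho> * P_norm A \<tau> \<sigma> ((X k, y k) - (Xs, ys))) \<and>
        (\<forall>\<^sub>F k in sequentially.
          P_triple_norm A \<tau> \<sigma> ((X (Suc k), y (Suc k), S (Suc k)) - (Xs, ys, Ss))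
            \<le> \<rho> * P_triple_norm A \<tau> \<sigma> ((X k, y k, S k) - (Xs, ys, Ss)))))"
proof -
  define z where "z k = (X k, y k)" for k
  have sdp: "sdp_pdhg A C \<tau> \<sigma>"
    using C_sym A_sym step_sizes by unfold_locales auto
  have lim: "z \<longlonglongrightarrow> (Xs, ys)"
    using tendsto_Pair[OF tendsto_fst[OF conv] tendsto_fst[OF tendsto_snd[OF conv]]]
    by (simp add: z_def[abs_def])
  have run: "strict_pdhg_run A b C \<tau> \<sigma> Xs Ss ys Q I z" if "common_eigenframe Xs Ss Q I" for Q I
    using sdp KKT_limit that init pdhg lim
    by (simp add: strict_pdhg_run_def strict_pdhg_run_axioms_def strict_kkt_point_def
        strict_kkt_point_axioms_def z_def[abs_def])
  have Ss: "Ss = C - adjA A ys" using KKT_limit by (auto simp: KKT_set_def algebra_simps)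
  have exists_frame: "\<exists>Q I. common_eigenframe Xs Ss Q I"
    using KKT_limit strict_compl by (intro common_eigenframe_exists) (auto simp: KKT_set_def)
  obtain La where La: "La > 0" "\<And>v. norm (adjA A v) \<le> La * norm v"
    using linear_bounded_pos[OF linear_adjA[of A]] by blast
  have triple: "norm U + norm v + norm (adjA A v) \<le> (2 + La) * norm (U, v)" for U v
  proof -
    have "norm U \<le> norm (U, v)" "norm v \<le> norm (U, v)" by (rule norm_fst_le, rule norm_snd_le)
    moreover from this(2) have "La * norm v \<le> La * norm (U, v)" using La(1) by simp
    ultimately show ?thesis using La(2)[of v] unfolding distrib_right by linarith
  qed
  have geometric: "\<exists>\<rho> k0. 0 < \<rho> \<and> \<rho> < 1 \<and>
        (\<forall>k\<ge>k0. P_dist A \<tau> \<sigma> (X (Suc k), y (Suc k)) (KKT_manifold A b C Q I)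
            \<le> \<rho> * P_dist A \<tau> \<sigma> (X k, y k) (KKT_manifold A b C Q I)) \<and>
        (\<exists>\<kappa>>0. \<forall>k\<ge>k0.
          P_dist A \<tau> \<sigma> (X k, y k) (KKT_manifold A b C Q I) \<le> \<kappa> * \<rho> ^ (k - k0) \<and>
          infdist (X k, y k, S k) (KKT_set A b C) \<le> \<kappa> * \<rho> ^ (k - k0) \<and>
          norm (X (Suc k) - X k) + norm (y (Suc k) - y k) + norm (S (Suc k) - S k)
            \<le> \<kappa> * \<rho> ^ (k - k0) \<and>
          norm (X k - Xs) + norm (y k - ys) + norm (S k - Ss) \<le> \<kappa> * \<rho> ^ (k - k0))"
    if frame: "common_eigenframe Xs Ss Q I" for Q I
  proof -
    interpret strict_pdhg_run A b C \<tau> \<sigma> Xs Ss ys Q I z by (rule run[OF frame])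
    obtain \<rho> k0 where \<rho>: "0 < \<rho>" "\<rho> < 1" and contr: "\<And>k. k \<ge> k0 \<Longrightarrow> D (Suc k) \<le> \<rho> * D k"
      using dist_contraction by metis
    obtain G where G: "G > 0" "\<And>k. norm (z (Suc k) - z k) \<le> G * D k"
      "\<And>k. norm (z k - (Xs, ys)) \<le> G * D k"
      using dist_to_limit_le by metis
    have geo: "D k \<le> D k0 * \<rho> ^ (k - k0)" if "k \<ge> k0" for k
      using that
    proof (induction k rule: dec_induct)
      case (step k)
      have "D (Suc k) \<le> \<rho> * D k" by (rule contr[OF step.hyps(1)])
      also have "\<dots> \<le> \<rho> * (D k0 * \<rho> ^ (k - k0))" using step.IH \<rho>(1) by simp
      finally show ?case using step.hyps(1) by (simp add: Suc_diff_le ac_simps)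
    qed simp
    define F where "F = 1 + (2 + La) * G"
    have F: "F \<ge> 1" "(2 + La) * G \<le> F" using G(1) La(1) by (simp_all add: F_def)
    \<comment> \<open>Adding 1 keeps the constant positive when the run has already reached the manifold.\<close>
    define \<kappa> where "\<kappa> = F * (D k0 + 1)"
    have "\<kappa> > 0" using F(1) dist_nonneg[of k0] by (simp add: \<kappa>_def)
    have bound: "F * D k \<le> \<kappa> * \<rho> ^ (k - k0)" if "k \<ge> k0" for k
    proof -
      have "D k \<le> (D k0 + 1) * \<rho> ^ (k - k0)"
        using geo[OF that] \<rho>(1) by (simp add: distrib_right add_increasing2)
      then show ?thesis using F(1) by (simp add: \<kappa>_def mult.assoc)
    qed
    have scaled: "(2 + La) * norm u \<le> F * D k" if "norm u \<le> G * D k"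
      for u :: "(real^'n^'n) \<times> (real^'m)" and k
    proof -
      have "(2 + La) * norm u \<le> (2 + La) * G * D k"
        using mult_left_mono[OF that, of "2 + La"] La(1) by (simp add: mult.assoc)
      also have "\<dots> \<le> F * D k" using F(2) dist_nonneg by (rule mult_right_mono)
      finally show ?thesis .
    qed
    have step_bound: "norm (X (Suc k) - X k) + norm (y (Suc k) - y k) + norm (S (Suc k) - S k) \<le> F * D k" for k
    proof -
      have "S (Suc k) - S k = - adjA A (y (Suc k) - y k)"
        by (simp add: slack linear_diff[OF linear_adjA])
      then show ?thesis
        using triple[of "X (Suc k) - X k" "y (Suc k) - y k"] scaled[OF G(2)[of k]]
        by (simp add: z_def)
    qed
    have error_bound: "norm (X k - Xs) + norm (y k - ys) + norm (S k - Ss) \<le> F * D k" for k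
    proof -
      have "S k - Ss = - adjA A (y k - ys)"
        by (simp add: slack Ss linear_diff[OF linear_adjA])
      then show ?thesis
        using triple[of "X k - Xs" "y k - ys"] scaled[OF G(3)[of k]] by (simp add: z_def)
    qed
    have "infdist (X k, y k, S k) (KKT_set A b C) \<le> F * D k" for k
    proof -
      have "infdist (X k, y k, S k) (KKT_set A b C) \<le> dist (X k, y k, S k) (Xs, ys, Ss)"
        by (rule infdist_le[OF KKT_limit])
      also have "\<dots> \<le> norm (X k - Xs) + (norm (y k - ys) + norm (S k - Ss))"
        unfolding dist_norm minus_prod_def fst_conv snd_conv
        by (rule order_trans[OF norm_Pair_le add_left_mono[OF norm_Pair_le]])
      finally show ?thesis using error_bound[of k] by linarith
    qed
    moreover have "D k \<le> F * D k" for k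
      using mult_right_mono[OF F(1) dist_nonneg[of k]] by simp
    ultimately have "\<forall>k\<ge>k0. D k \<le> \<kappa> * \<rho> ^ (k - k0) \<and>
        infdist (X k, y k, S k) (KKT_set A b C) \<le> \<kappa> * \<rho> ^ (k - k0) \<and>
        norm (X (Suc k) - X k) + norm (y (Suc k) - y k) + norm (S (Suc k) - S k) \<le> \<kappa> * \<rho> ^ (k - k0) \<and>
        norm (X k - Xs) + norm (y k - ys) + norm (S k - Ss) \<le> \<kappa> * \<rho> ^ (k - k0)"
      using bound step_bound error_bound by (meson order_trans)
    then show ?thesis using \<rho> contr \<open>\<kappa> > 0\<close> unfolding z_def by blast
  qed
  have isolated: "\<exists>\<rho>. 0 < \<rho> \<and> \<rho> < 1 \<and>
        (\<forall>\<^sub>F k in sequentially. P_norm A \<tau> \<sigma> ((X (Suc k), y (Suc k)) - (Xs, ys))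
            \<le> \<rho> * P_norm A \<tau> \<sigma> ((X k, y k) - (Xs, ys))) \<and>
        (\<forall>\<^sub>F k in sequentially.
          P_triple_norm A \<tau> \<sigma> ((X (Suc k), y (Suc k), S (Suc k)) - (Xs, ys, Ss))
            \<le> \<rho> * P_triple_norm A \<tau> \<sigma> ((X k, y k, S k) - (Xs, ys, Ss)))"
    if iso: "(Xs, ys, Ss) isolated_in KKT_set A b C"
  proof -
    obtain Q I where frame: "common_eigenframe Xs Ss Q I" using exists_frame by blast
    interpret strict_pdhg_run A b C \<tau> \<sigma> Xs Ss ys Q I z by (rule run[OF frame])
    obtain \<rho> k0 where \<rho>: "0 < \<rho>" "\<rho> < 1" and contr: "\<And>k. k \<ge> k0 \<Longrightarrow> D (Suc k) \<le> \<rho> * D k"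
      using dist_contraction by metis
    have "D k = P_norm A \<tau> \<sigma> ((X k, y k) - (Xs, ys))" for k
      by (simp add: isolated_manifold[OF iso] P_dist_def z_def)
    then have "\<forall>\<^sub>F k in sequentially. P_norm A \<tau> \<sigma> ((X (Suc k), y (Suc k)) - (Xs, ys))
            \<le> \<rho> * P_norm A \<tau> \<sigma> ((X k, y k) - (Xs, ys))"
      using contr by (auto simp: eventually_sequentially)
    then show ?thesis using \<rho> by (intro exI[of _ \<rho>]) (simp add: P_triple_norm_def)
  qed
  show ?thesis using exists_frame geometric isolated by blast
qed

end
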